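(* Let $\mathcal{I}\subseteq\Phi^+(C_\ell)$ be an ideal. Let $s:=\min\{1\le i\le\ell: 2\epsilon_i\in\mathcal{I}\}$ if such $i$ exists and $s:=\ell+1$ otherwise, and let $n:=\min\big(\{1\le i\le\ell: E_i(\mathcal{I})\ne\emptyset\}\cup\{s\}\big)$. Then the toric arrangement $\mathscr{A}_{T_{\mathcal{I}}}$ with respect to the integer lattice is strictly supersolvable with exponents $$\exp(\mathscr{A}_{T_{\mathcal{I}}})=\{0^{n-1}\}\cup\{b_i\}_{i=n}^{s-1}\cup\{2(\ell-i+1)\}_{i=s}^{\ell}.$$
   Context: Let $\epsilon_1,\dots,\epsilon_\ell$ be the standard basis of $\mathbb{R}^\ell$. $\Phi^+(C_\ell)=\{2\epsilon_i\ (1\le i\le\ell),\ \epsilon_i\pm\epsilon_j\ (1\le i<j\le\ell)\}$ with base $\alpha_i=\epsilon_i-\epsilon_{i+1}$ ($1\le i<\ell$), $\alpha_\ell=2\epsilon_\ell$. Order $\Phi^+$ by $\beta_1\ge\beta_2$ iff $\beta_1-\beta_2$ is a nonnegative integer combination of the $\alpha_i$; an ideal is a downward-closed subset. $E_i(\mathcal{I}):=\{\epsilon_i\pm\epsilon_j\in\mathcal{I}: j>i\}$ and $b_i:=|E_i(\mathcal{I})|$. For $\beta=\sum_i c_i\epsilon_i\in\mathcal{I}$ let $H_\beta=\{t\in(\mathbb{S}^1)^\ell:t_1^{c_1}\cdots t_\ell^{c_\ell}=1\}$; $\mathscr{A}_{T_{\mathcal{I}}}$ is the set of connected components of the $H_\beta$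 (e.g. $2\epsilon_i$ contributes $\{t_i=1\}$ and $\{t_i=-1\}$). The poset of layers $L(\mathscr{A})$ consists of connected components of nonempty intersections of subsets of $\mathscr{A}$ (empty intersection $=(\mathbb{S}^1)^\ell$), ordered by reverse inclusion, rank $=$ codimension; $\chi_{\mathscr{A}}(t)=\sum_X\mu(T,X)t^{\dim X}$; if $\chi_{\mathscr{A}}(t)=t^{\ell-r}\prod_{i=1}^r(t-d_i)$ ($r$ the rank, $d_i$ positive integers), $\exp(\mathscr{A})=\{0^{\ell-r},d_1,\dots,d_r\}$ ($e^d$ = multiplicity $d$). $\mathscr{A}$ is strictly supersolvable if $L(\mathscr{A})$ is: for a poset $\mathcal{P}$ (finite, minimum $\hat0$, ranked, each $\mathcal{P}_{\le x}$ a geometric lattice), a TM-ideal is a pure (maximal elements of equal rank), join-closed ($T\subseteq\mathcal{Q}\Rightarrow$ all minimal upper bounds of $T$ lie in $\mathcal{Q}$) order ideal $\mathcal{Q}$ such that each atom $a\notin\mathcal{Q}$ and $y\in\mathcal{Q}$ have exactly one minimal upper bound, and for every maximal $x\in\mathcal{P}$ some maximal $y\in\mathcal{Q}$ is modular in the lattice $\mathcal{P}_{\le x}$ (i.e. $y\wedge(w\vee z)=(y\wedge w)\vee z$ for $z\le y$); $\mathcal{P}$ is strictly supersolvable if there is a chain $\{\hat0\}=\mathcal{Q}_0\subsetneq\cdots\subsetneq\mathcal{Q}_r=\mathcal{P}$ with $\mathcal{Q}_i$ a TM-ideal of $\mathcal{Q}_{i+1}$ and $\operatorname{rk}\mathcal{Q}_i=i$.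 *)

theory Defs
  imports "HOL-Analysis.Analysis" "HOL-Computational_Algebra.Polynomial" "HOL-Library.Multiset"
begin

definition lt_in :: "('a \<Rightarrow> 'a \<Rightarrow> bool) \<Rightarrow> 'a \<Rightarrow> 'a \<Rightarrow> bool" where
  "lt_in le x y \<longleftrightarrow> le x y \<and> x \<noteq> y"

definition is_partial_order_on :: "'a set \<Rightarrow> ('a \<Rightarrow> 'a \<Rightarrow> bool) \<Rightarrow> bool" where
  "is_partial_order_on P le \<longleftrightarrow>
     (\<forall>x\<in>P. le x x) \<and>
     (\<forall>x\<in>P. \<forall>y\<in>P. le x y \<and> le y x \<longrightarrow> x = y) \<and>
     (\<forall>x\<in>P. \<forall>y\<in>P. \<forall>z\<in>P. le x y \<and> le y z \<longrightarrow> le x z)"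

definition is_chain_in :: "('a \<Rightarrow> 'a \<Rightarrow> bool) \<Rightarrow> 'a set \<Rightarrow> bool" where
  "is_chain_in le C \<longleftrightarrow> (\<forall>x\<in>C. \<forall>y\<in>C. le x y \<or> le y x)"

definition is_minimum :: "'a set \<Rightarrow> ('a \<Rightarrow> 'a \<Rightarrow> bool) \<Rightarrow> 'a \<Rightarrow> bool" where
  "is_minimum P le b \<longleftrightarrow> b \<in> P \<and> (\<forall>x\<in>P. le b x)"

definition below :: "'a set \<Rightarrow> ('a \<Rightarrow> 'a \<Rightarrow> bool) \<Rightarrow> 'a \<Rightarrow> 'a set" where
  "below P le x = {z\<in>P. le z x}"

text \<open>Rank of an element: length of the longest chain from the bottom to x
  (= number of elements of a longest chain strictly below x).\<close>
definition rk_in :: "'a set \<Rightarrow> ('a \<Rightarrow> 'a \<Rightarrow> bool) \<Rightarrow> 'a \<Rightarrow> nat" where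
  "rk_in P le x = Max {card C | C. C \<subseteq> {z\<in>P. lt_in le z x} \<and> is_chain_in le C}"

definition rk_poset :: "'a set \<Rightarrow> ('a \<Rightarrow> 'a \<Rightarrow> bool) \<Rightarrow> nat" where
  "rk_poset P le = Max (rk_in P le ` P)"

definition ranked :: "'a set \<Rightarrow> ('a \<Rightarrow> 'a \<Rightarrow> bool) \<Rightarrow> bool" where
  "ranked P le \<longleftrightarrow> (\<forall>x\<in>P. \<forall>C. C \<subseteq> below P le x \<and> is_chain_in le C \<and>
       (\<forall>D. C \<subseteq> D \<and> D \<subseteq> below P le x \<and> is_chain_in le D \<longrightarrow> D = C)
       \<longrightarrow> card C = rk_in P le x + 1)"

definition maximal_in :: "'a set \<Rightarrow> ('a \<Rightarrow> 'a \<Rightarrow> bool) \<Rightarrow> 'a \<Rightarrow> bool" where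
  "maximal_in P le x \<longleftrightarrow> x \<in> P \<and> \<not> (\<exists>y\<in>P. lt_in le x y)"

definition is_upper_bound :: "('a \<Rightarrow> 'a \<Rightarrow> bool) \<Rightarrow> 'a set \<Rightarrow> 'a \<Rightarrow> bool" where
  "is_upper_bound le S u \<longleftrightarrow> (\<forall>s\<in>S. le s u)"

definition is_lower_bound :: "('a \<Rightarrow> 'a \<Rightarrow> bool) \<Rightarrow> 'a set \<Rightarrow> 'a \<Rightarrow> bool" where
  "is_lower_bound le S u \<longleftrightarrow> (\<forall>s\<in>S. le u s)"

definition is_lub :: "'a set \<Rightarrow> ('a \<Rightarrow> 'a \<Rightarrow> bool) \<Rightarrow> 'a set \<Rightarrow> 'a \<Rightarrow> bool" where
  "is_lub Q le S j \<longleftrightarrow> j \<in> Q \<and> is_upper_bound le S j \<and>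
      (\<forall>u\<in>Q. is_upper_bound le S u \<longrightarrow> le j u)"

definition is_glb :: "'a set \<Rightarrow> ('a \<Rightarrow> 'a \<Rightarrow> bool) \<Rightarrow> 'a set \<Rightarrow> 'a \<Rightarrow> bool" where
  "is_glb Q le S m \<longleftrightarrow> m \<in> Q \<and> is_lower_bound le S m \<and>
      (\<forall>u\<in>Q. is_lower_bound le S u \<longrightarrow> le u m)"

definition join_in :: "'a set \<Rightarrow> ('a \<Rightarrow> 'a \<Rightarrow> bool) \<Rightarrow> 'a \<Rightarrow> 'a \<Rightarrow> 'a" where
  "join_in Q le a b = (THE j. is_lub Q le {a, b} j)"

definition meet_in :: "'a set \<Rightarrow> ('a \<Rightarrow> 'a \<Rightarrow> bool) \<Rightarrow> 'a \<Rightarrow> 'a \<Rightarrow> 'a" where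
  "meet_in Q le a b = (THE m. is_glb Q le {a, b} m)"

definition is_lattice :: "'a set \<Rightarrow> ('a \<Rightarrow> 'a \<Rightarrow> bool) \<Rightarrow> bool" where
  "is_lattice Q le \<longleftrightarrow> (\<forall>a\<in>Q. \<forall>b\<in>Q. (\<exists>j. is_lub Q le {a, b} j) \<and> (\<exists>m. is_glb Q le {a, b} m))"

definition is_atom :: "'a set \<Rightarrow> ('a \<Rightarrow> 'a \<Rightarrow> bool) \<Rightarrow> 'a \<Rightarrow> bool" where
  "is_atom P le a \<longleftrightarrow> a \<in> P \<and> rk_in P le a = 1"

definition geometric_lattice :: "'a set \<Rightarrow> ('a \<Rightarrow> 'a \<Rightarrow> bool) \<Rightarrow> bool" where
  "geometric_lattice Q le \<longleftrightarrow> finite Q \<and> is_partial_order_on Q le \<and> is_lattice Q le \<and>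
     (\<forall>a\<in>Q. \<forall>b\<in>Q. rk_in Q le (join_in Q le a b) + rk_in Q le (meet_in Q le a b)
                      \<le> rk_in Q le a + rk_in Q le b) \<and>
     (\<forall>y\<in>Q. is_lub Q le {a\<in>Q. is_atom Q le a \<and> le a y} y)"

definition modular_elem :: "'a set \<Rightarrow> ('a \<Rightarrow> 'a \<Rightarrow> bool) \<Rightarrow> 'a \<Rightarrow> bool" where
  "modular_elem Q le y \<longleftrightarrow> y \<in> Q \<and> (\<forall>w\<in>Q. \<forall>z\<in>Q. le z y \<longrightarrow>
      meet_in Q le y (join_in Q le w z) = join_in Q le (meet_in Q le y w) z)"

definition mubs :: "'a set \<Rightarrow> ('a \<Rightarrow> 'a \<Rightarrow> bool) \<Rightarrow> 'a set \<Rightarrow> 'a set" where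
  "mubs P le T = {u\<in>P. is_upper_bound le T u \<and> \<not> (\<exists>v\<in>P. is_upper_bound le T v \<and> lt_in le v u)}"

definition order_ideal :: "'a set \<Rightarrow> ('a \<Rightarrow> 'a \<Rightarrow> bool) \<Rightarrow> 'a set \<Rightarrow> bool" where
  "order_ideal P le Q \<longleftrightarrow> Q \<subseteq> P \<and> (\<forall>y\<in>Q. \<forall>z\<in>P. le z y \<longrightarrow> z \<in> Q)"

definition TM_ideal :: "'a set \<Rightarrow> ('a \<Rightarrow> 'a \<Rightarrow> bool) \<Rightarrow> 'a set \<Rightarrow> bool" where
  "TM_ideal P le Q \<longleftrightarrow> order_ideal P le Q \<and>
     \<comment> \<open>pure\<close>
     (\<forall>y1 y2. maximal_in Q le y1 \<and> maximal_in Q le y2 \<longrightarrow> rk_in P le y1 = rk_in P le y2) \<and>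
     \<comment> \<open>join-closed\<close>
     (\<forall>T. T \<subseteq> Q \<longrightarrow> mubs P le T \<subseteq> Q) \<and>
     \<comment> \<open>atoms outside Q\<close>
     (\<forall>a y. is_atom P le a \<and> a \<notin> Q \<and> y \<in> Q \<longrightarrow> card (mubs P le {a, y}) = 1 \<and> finite (mubs P le {a, y})) \<and>
     \<comment> \<open>modularity\<close>
     (\<forall>x. maximal_in P le x \<longrightarrow>
        (\<exists>y. maximal_in Q le y \<and> le y x \<and> modular_elem (below P le x) le y))"

definition strictly_supersolvable :: "'a set \<Rightarrow> ('a \<Rightarrow> 'a \<Rightarrow> bool) \<Rightarrow> bool" where
  "strictly_supersolvable P le \<longleftrightarrow>
     finite P \<and> is_partial_order_on P le \<and> ranked P le \<and>
     (\<exists>b. is_minimum P le b \<and>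
        (\<forall>x\<in>P. geometric_lattice (below P le x) le) \<and>
        (\<exists>Qs :: nat \<Rightarrow> 'a set.
           Qs 0 = {b} \<and> Qs (rk_poset P le) = P \<and>
           (\<forall>i < rk_poset P le. Qs i \<subset> Qs (Suc i) \<and> TM_ideal (Qs (Suc i)) le (Qs i)) \<and>
           (\<forall>i \<le> rk_poset P le. rk_poset (Qs i) le = i)))"

definition mobius :: "'a set \<Rightarrow> ('a \<Rightarrow> 'a \<Rightarrow> bool) \<Rightarrow> 'a \<Rightarrow> 'a \<Rightarrow> int" where
  "mobius P le x = (THE m :: 'a \<Rightarrow> int.
      m x = 1 \<and>
      (\<forall>y\<in>P. le x y \<and> y \<noteq> x \<longrightarrow> m y = - (\<Sum>z\<in>{z\<in>P. le x z \<and> lt_in le z y}. m z)) \<and>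
      (\<forall>y. \<not> (y \<in> P \<and> le x y) \<longrightarrow> m y = 0))"

type_synonym ivec = "nat \<Rightarrow> int"

definition eps :: "nat \<Rightarrow> ivec" where
  "eps i = (\<lambda>k. if k = i then 1 else 0)"

definition vadd :: "ivec \<Rightarrow> ivec \<Rightarrow> ivec" where "vadd u v = (\<lambda>k. u k + v k)"
definition vsub :: "ivec \<Rightarrow> ivec \<Rightarrow> ivec" where "vsub u v = (\<lambda>k. u k - v k)"
definition vscale :: "int \<Rightarrow> ivec \<Rightarrow> ivec" where "vscale c v = (\<lambda>k. c * v k)"

definition pos_roots_C :: "nat \<Rightarrow> ivec set" where
  "pos_roots_C l = {vscale 2 (eps i) | i. 1 \<le> i \<and> i \<le> l}
     \<union> {vadd (eps i) (eps j) | i j. 1 \<le> i \<and> i < j \<and> j \<le> l}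
     \<union> {vsub (eps i) (eps j) | i j. 1 \<le> i \<and> i < j \<and> j \<le> l}"

definition simple_root_C :: "nat \<Rightarrow> nat \<Rightarrow> ivec" where
  "simple_root_C l i = (if i < l then vsub (eps i) (eps (Suc i)) else vscale 2 (eps l))"

definition root_le :: "nat \<Rightarrow> ivec \<Rightarrow> ivec \<Rightarrow> bool" where
  "root_le l \<gamma> \<beta> \<longleftrightarrow> (\<exists>c :: nat \<Rightarrow> nat. \<forall>k. \<beta> k - \<gamma> k = (\<Sum>i=1..l. int (c i) * simple_root_C l i k))"

definition root_ideal :: "nat \<Rightarrow> ivec set \<Rightarrow> bool" where
  "root_ideal l I \<longleftrightarrow> I \<subseteq> pos_roots_C l \<and>
     (\<forall>\<beta>\<in>I. \<forall>\<gamma>\<in>pos_roots_C l. root_le l \<gamma> \<beta> \<longrightarrow> \<gamma> \<in> I)"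

definition E_set :: "nat \<Rightarrow> ivec set \<Rightarrow> nat \<Rightarrow> ivec set" where
  "E_set l I i = {\<beta>\<in>I. \<exists>j. i < j \<and> j \<le> l \<and> (\<beta> = vadd (eps i) (eps j) \<or> \<beta> = vsub (eps i) (eps j))}"

definition b_num :: "nat \<Rightarrow> ivec set \<Rightarrow> nat \<Rightarrow> nat" where
  "b_num l I i = card (E_set l I i)"

definition s_idx :: "nat \<Rightarrow> ivec set \<Rightarrow> nat" where
  "s_idx l I = Min ({i. 1 \<le> i \<and> i \<le> l \<and> vscale 2 (eps i) \<in> I} \<union> {Suc l})"

definition n_idx :: "nat \<Rightarrow> ivec set \<Rightarrow> nat" where
  "n_idx l I = Min ({i. 1 \<le> i \<and> i \<le> l \<and> E_set l I i \<noteq> {}} \<union> {s_idx l I})"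

text \<open>The compact torus \<open>(S^1)^l\<close>, realized inside \<open>nat \<Rightarrow> complex\<close> (product topology),
  coordinates outside \<open>{1..l}\<close> fixed to 1.\<close>
definition torus :: "nat \<Rightarrow> (nat \<Rightarrow> complex) set" where
  "torus l = {t. (\<forall>i\<in>{1..l}. cmod (t i) = 1) \<and> (\<forall>i. i \<notin> {1..l} \<longrightarrow> t i = 1)}"

definition hypertorus :: "nat \<Rightarrow> ivec \<Rightarrow> (nat \<Rightarrow> complex) set" where
  "hypertorus l \<beta> = {t\<in>torus l. (\<Prod>i=1..l. t i powi \<beta> i) = 1}"

definition toric_arr :: "nat \<Rightarrow> ivec set \<Rightarrow> (nat \<Rightarrow> complex) set set" where
  "toric_arr l I = (\<Union>\<beta>\<in>I. components (hypertorus l \<beta>))"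

text \<open>Poset of layers: connected components of intersections of subsets of the arrangement,
  ordered by reverse inclusion (the empty intersection is the whole torus).\<close>
definition layers :: "nat \<Rightarrow> ivec set \<Rightarrow> (nat \<Rightarrow> complex) set set" where
  "layers l I = {X. \<exists>B \<subseteq> toric_arr l I. X \<in> components (torus l \<inter> \<Inter>B)}"

definition rev_incl :: "'a set \<Rightarrow> 'a set \<Rightarrow> bool" where
  "rev_incl X Y \<longleftrightarrow> Y \<subseteq> X"

text \<open>Dimension of a layer \<open>= l - rank\<close> (rank = codimension).\<close>
definition layer_dim :: "nat \<Rightarrow> ivec set \<Rightarrow> (nat \<Rightarrow> complex) set \<Rightarrow> nat" where
  "layer_dim l I X = l - rk_in (layers l I) rev_incl X"

definition char_poly :: "nat \<Rightarrow> ivec set \<Rightarrow> int poly" where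
  "char_poly l I = (\<Sum>X\<in>layers l I. monom (mobius (layers l I) rev_incl (torus l) X) (layer_dim l I X))"

definition has_exponents :: "nat \<Rightarrow> ivec set \<Rightarrow> nat multiset \<Rightarrow> bool" where
  "has_exponents l I E \<longleftrightarrow>
     (let r = rk_poset (layers l I) rev_incl in
      \<exists>ds :: nat multiset. (\<forall>d\<in>#ds. 0 < d) \<and> size ds = r \<and>
        char_poly l I = monom 1 (l - r) * (\<Prod>d\<in>#ds. [:- int d, 1:]) \<and>
        E = replicate_mset (l - r) 0 + ds)"

end

theory Submission
  imports Defs
begin

text \<open>
  Add the coordinates \<open>t\<^sub>\<ell>, t\<^sub>\<ell>\<^sub>-\<^sub>1, \<dots>, t\<^sub>1\<close> one at a time. The hypersurfaces whose leading
  coordinate is \<open>i\<close> are the graphs \<open>t\<^sub>i = t\<^sub>j\<close>, \<open>t\<^sub>i = t\<^sub>j\<^sup>-\<^sup>1\<close>, \<open>t\<^sub>i = 1\<close>, \<open>t\<^sub>i = -1\<close> of functions of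
  the later coordinates. Because \<open>I\<close> is an ideal, any two of these graphs coincide precisely
  over hypersurfaces that already belong to the arrangement in the later coordinates. Hence the
  new layers are the old layers \<open>Y\<close> together with the restrictions \<open>Y \<inter> a\<close> of the graphs \<open>a\<close>;
  the old layers form a TM-ideal in which the projection of a layer is modular, and the number
  of graphs is the new exponent. Coordinates without any graph contribute the exponent \<open>0\<close>.
\<close>

section \<open>Rank and joins in families of sets ordered by reverse inclusion\<close>

text \<open>The obstacle is that intersections of hypersurfaces may be disconnected, so the layers
  do not form a lattice; every condition on joins is localized, either below a common upper bound or
  at a point that selects a component. Layers in the later coordinates are not taken in a smaller
  torus: they stay in the full torus as sets invariant under rotating the coordinates still to be
  treated, so each old poset is literally a subset of the next one and projection becomes a closure
  operator. The ideal property makes two roots of row \<open>i\<close> force the root that cuts out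
  the agreement locus of their graphs. For example \<open>t\<^sub>i = t\<^sub>j\<close> and
  \<open>t\<^sub>i = 1/t\<^sub>k\<close> agree where \<open>t\<^sub>j t\<^sub>k = 1\<close>, and
  \<open>\<epsilon>\<^sub>j + \<epsilon>\<^sub>k\<close> lies below
  \<open>\<epsilon>\<^sub>i + \<epsilon>\<^sub>k\<close>. The constant \<open>2 (l - i + 1)\<close>
  counts the \<open>2 (l - i)\<close> graphs \<open>t\<^sub>i = t\<^sub>j\<close> and
  \<open>t\<^sub>i = 1/t\<^sub>j\<close> together with \<open>t\<^sub>i = 1\<close> and
  \<open>t\<^sub>i = -1\<close>.\<close>

lemma lt_rev_incl: "lt_in rev_incl X Y \<longleftrightarrow> Y \<subset> X"
  by (auto simp: lt_in_def rev_incl_def)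

lemma below_rev_incl: "below P rev_incl u = {z \<in> P. u \<subseteq> z}"
  by (simp add: below_def rev_incl_def)

lemma partial_order_rev_incl: "is_partial_order_on P rev_incl"
  by (auto simp: is_partial_order_on_def rev_incl_def)

lemma is_lub_rev_incl:
  "is_lub Q rev_incl S j \<longleftrightarrow> j \<in> Q \<and> (\<forall>s\<in>S. j \<subseteq> s) \<and> (\<forall>v\<in>Q. (\<forall>s\<in>S. v \<subseteq> s) \<longrightarrow> v \<subseteq> j)"
  by (simp add: is_lub_def is_upper_bound_def rev_incl_def)

lemma is_glb_rev_incl:
  "is_glb Q rev_incl S j \<longleftrightarrow> j \<in> Q \<and> (\<forall>s\<in>S. s \<subseteq> j) \<and> (\<forall>v\<in>Q. (\<forall>s\<in>S. s \<subseteq> v) \<longrightarrow> j \<subseteq> v)"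
  by (simp add: is_glb_def is_lower_bound_def rev_incl_def)

lemma join_in_eq: "is_lub Q rev_incl {x, y} j \<Longrightarrow> join_in Q rev_incl x y = j"
  unfolding join_in_def
  by (rule the_equality) (auto simp: is_lub_rev_incl intro!: subset_antisym)

lemma meet_in_eq: "is_glb Q rev_incl {x, y} m \<Longrightarrow> meet_in Q rev_incl x y = m"
  unfolding meet_in_def
  by (rule the_equality) (auto simp: is_glb_rev_incl intro!: subset_antisym)

lemma rk_in_below:
  "u \<subseteq> x \<Longrightarrow> rk_in {z \<in> P. u \<subseteq> z} rev_incl x = rk_in P rev_incl x"
proof -
  assume "u \<subseteq> x"
  then have "{z \<in> {z \<in> P. u \<subseteq> z}. lt_in rev_incl z x} = {z \<in> P. lt_in rev_incl z x}"
    by (auto simp: lt_rev_incl)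
  then show ?thesis
    by (simp add: rk_in_def)
qed

lemma maximal_rev_incl: "maximal_in P rev_incl x \<longleftrightarrow> x \<in> P \<and> (\<forall>y\<in>P. y \<subseteq> x \<longrightarrow> y = x)"
  by (auto simp: maximal_in_def lt_rev_incl)

text \<open>Joins are only required below a common upper bound \<open>u\<close>, since two layers may meet in
  several components; two axioms on atoms suffice to make every interval a geometric lattice
  with rank \<open>\<rho>\<close>.\<close>

locale layer_poset =
  fixes P :: "'a set set" and T :: "'a set" and \<rho> :: "'a set \<Rightarrow> nat" and At :: "'a set set"
  assumes fin: "finite P"
    and T_in: "T \<in> P"
    and sub_T: "\<And>x. x \<in> P \<Longrightarrow> x \<subseteq> T"
    and rank_T: "\<rho> T = 0"
    and At_sub: "At \<subseteq> P"
    and T_not_At: "T \<notin> At"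
    and join_atom: "\<And>u x c. \<lbrakk>u \<in> P; x \<in> P; c \<in> At; u \<subseteq> x; u \<subseteq> c; \<not> x \<subseteq> c\<rbrakk> \<Longrightarrow>
      \<exists>j\<in>P. u \<subseteq> j \<and> j \<subseteq> x \<and> j \<subseteq> c \<and> \<rho> j = Suc (\<rho> x) \<and>
        (\<forall>v\<in>P. u \<subseteq> v \<longrightarrow> v \<subseteq> x \<longrightarrow> v \<subseteq> c \<longrightarrow> v \<subseteq> j)"
    and atom_sep: "\<And>x y. \<lbrakk>x \<in> P; y \<in> P; y \<subset> x\<rbrakk> \<Longrightarrow> \<exists>c\<in>At. y \<subseteq> c \<and> \<not> x \<subseteq> c"
begin

lemma cover:
  assumes "x \<in> P" "y \<in> P" "y \<subset> x"
  shows "\<exists>j\<in>P. y \<subseteq> j \<and> j \<subset> x \<and> \<rho> j = Suc (\<rho> x)"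
proof -
  obtain c where c: "c \<in> At" "y \<subseteq> c" "\<not> x \<subseteq> c"
    using atom_sep[OF assms] by blast
  then obtain j where "j \<in> P" "y \<subseteq> j" "j \<subseteq> x" "j \<subseteq> c" "\<rho> j = Suc (\<rho> x)"
    using join_atom[of y x c] assms by blast
  with c show ?thesis by blast
qed

text \<open>Iterating \<open>cover\<close> from \<open>x\<close> towards \<open>y\<close> raises the
  rank by one per step. The chain omits \<open>y\<close>, so with \<open>x = T\<close> it consists
  of elements strictly below \<open>y\<close> in the order, which is what \<open>rk_in\<close>
  counts.\<close>

lemma chain_between:
  assumes "x \<in> P" "y \<in> P" "y \<subseteq> x"
  shows "\<rho> x \<le> \<rho> y \<and> (\<exists>C \<subseteq> {z \<in> P. y \<subset> z \<and> z \<subseteq> x}. is_chain_in rev_incl C \<and> \<rho> x + card C = \<rho> y)"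
  using assms
proof (induction "card {z \<in> P. z \<subset> x}" arbitrary: x rule: less_induct)
  case less
  show ?case
  proof (cases "x = y")
    case True
    then show ?thesis by (auto simp: is_chain_in_def intro!: exI[of _ "{}"])
  next
    case False
    then obtain j where j: "j \<in> P" "y \<subseteq> j" "j \<subset> x" "\<rho> j = Suc (\<rho> x)"
      using cover[of x y] less.prems by blast
    have "card {z \<in> P. z \<subset> j} < card {z \<in> P. z \<subset> x}"
      using j fin by (intro psubset_card_mono) auto
    note IH = less.hyps[OF this j(1) less.prems(2) j(2)]
    obtain C where C: "C \<subseteq> {z \<in> P. y \<subset> z \<and> z \<subseteq> j}" "is_chain_in rev_incl C"
      "\<rho> j + card C = \<rho> y" using conjunct2[OF IH] by (elim exE conjE)
    have "C \<subseteq> P" using C(1) by auto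
    then have "finite C" using fin by (rule finite_subset)
    moreover have "x \<notin> C" using C(1) j by blast
    ultimately have "\<rho> x + card (insert x C) = \<rho> y" using C(3) j by simp
    moreover have "is_chain_in rev_incl (insert x C)"
      using C(1,2) j(3) unfolding is_chain_in_def rev_incl_def by blast
    moreover have "insert x C \<subseteq> {z \<in> P. y \<subset> z \<and> z \<subseteq> x}"
      using C(1) j(3) less.prems False by blast
    ultimately show ?thesis by (intro conjI exI[of _ "insert x C"]) auto
  qed
qed

lemma rank_mono: "\<lbrakk>x \<in> P; y \<in> P; y \<subseteq> x\<rbrakk> \<Longrightarrow> \<rho> x \<le> \<rho> y"
  using conjunct1[OF chain_between] .

lemma rank_strict:
  assumes "x \<in> P" "y \<in> P" "y \<subset> x"
  shows "\<rho> x < \<rho> y"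
proof -
  obtain j where "j \<in> P" "y \<subseteq> j" "\<rho> j = Suc (\<rho> x)" using cover[OF assms] by blast
  with rank_mono[of j y] assms show ?thesis by simp
qed

lemma rank_inj_on_chain:
  assumes "C \<subseteq> P" "is_chain_in rev_incl C"
  shows "inj_on \<rho> C"
proof (rule inj_onI)
  fix x y assume xy: "x \<in> C" "y \<in> C" "\<rho> x = \<rho> y"
  then have "x \<in> P" "y \<in> P" "x \<subseteq> y \<or> y \<subseteq> x"
    using assms by (auto simp: is_chain_in_def rev_incl_def)
  with xy(3) show "x = y"
    using rank_strict[of x y] rank_strict[of y x] by auto
qed

lemma rk_in_eq:
  assumes "x \<in> P"
  shows "rk_in P rev_incl x = \<rho> x"
  unfolding rk_in_def lt_rev_incl
proof (rule Max_eqI)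
  have "{card C |C. C \<subseteq> {z \<in> P. x \<subset> z} \<and> is_chain_in rev_incl C} \<subseteq> card ` Pow P" by auto
  then show "finite {card C |C. C \<subseteq> {z \<in> P. x \<subset> z} \<and> is_chain_in rev_incl C}"
    using fin by (meson finite_Pow_iff finite_imageI finite_subset)
next
  fix k assume "k \<in> {card C |C. C \<subseteq> {z \<in> P. x \<subset> z} \<and> is_chain_in rev_incl C}"
  then obtain C where C: "k = card C" "C \<subseteq> {z \<in> P. x \<subset> z}" "is_chain_in rev_incl C" by blast
  then have "inj_on \<rho> C" by (intro rank_inj_on_chain) auto
  moreover have "\<rho> ` C \<subseteq> {..<\<rho> x}" using C rank_strict[of _ x] assms by auto
  ultimately have "card C \<le> card {..<\<rho> x}" by (metis card_inj_on_le finite_lessThan)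
  then show "k \<le> \<rho> x" using C by simp
next
  obtain C where "C \<subseteq> {z \<in> P. x \<subset> z \<and> z \<subseteq> T}" "is_chain_in rev_incl C" "\<rho> T + card C = \<rho> x"
    using chain_between[OF T_in assms sub_T[OF assms]] by blast
  then show "\<rho> x \<in> {card C |C. C \<subseteq> {z \<in> P. x \<subset> z} \<and> is_chain_in rev_incl C}"
    by (auto simp: rank_T intro!: exI[of _ C])
qed

text \<open>A maximal chain skips no rank: a gap between two neighbours could be filled by
  \<open>cover\<close>. Since \<open>\<rho>\<close> is injective on chains, its cardinality is the
  number of ranks from 0 to \<open>\<rho> x\<close>.\<close>

lemma ranked: "ranked P rev_incl"
  unfolding ranked_def below_rev_incl
proof (intro ballI allI impI, elim conjE)
  fix x C
  assume x: "x \<in> P" and C: "C \<subseteq> {z \<in> P. x \<subseteq> z}" "is_chain_in rev_incl C"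
    and max: "\<forall>D. C \<subseteq> D \<and> D \<subseteq> {z \<in> P. x \<subseteq> z} \<and> is_chain_in rev_incl D \<longrightarrow> D = C"
  have ins: "j \<in> C" if "j \<in> P" "x \<subseteq> j" "\<And>w. w \<in> C \<Longrightarrow> w \<subseteq> j \<or> j \<subseteq> w" for j
  proof -
    have "is_chain_in rev_incl (insert j C)"
      using that C by (auto simp: is_chain_in_def rev_incl_def)
    then have "insert j C = C" using max that C by blast
    then show ?thesis by blast
  qed
  have cmp: "y \<subseteq> w" if "w \<in> C" "y \<in> C" "\<rho> w \<le> \<rho> y" for w y
    using that C rank_strict[of y w] unfolding is_chain_in_def rev_incl_def by force
  have xC: "x \<in> C" by (rule ins) (use x C in auto)
  have TC: "T \<in> C" by (rule ins) (use x T_in sub_T C in auto)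
  have all: "r \<in> \<rho> ` C" if "r \<le> \<rho> x" for r
    using that
  proof (induction r)
    case 0
    show ?case using TC rank_T by force
  next
    case (Suc r)
    then obtain y where y: "y \<in> C" "\<rho> y = r" by auto
    \<comment> \<open>\<open>z\<close> is the neighbour of \<open>y\<close> in the chain. Any
      \<open>j\<close> between the two is comparable with the whole chain, hence belongs to it by
      maximality; \<open>cover\<close> supplies such a \<open>j\<close> of rank
      \<open>r + 1\<close>.\<close>
    define z where "z = arg_min_on \<rho> {w \<in> C. r < \<rho> w}"
    have fC: "finite {w \<in> C. r < \<rho> w}" using C(1) fin by (auto intro: finite_subset)
    have ne: "{w \<in> C. r < \<rho> w} \<noteq> {}" using xC Suc.prems by auto
    have z: "z \<in> C" "r < \<rho> z" using arg_min_if_finite(1)[OF fC ne, of \<rho>] by (auto simp: z_def)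
    have zmin: "\<rho> z \<le> \<rho> w" if "w \<in> C" "r < \<rho> w" for w
      using arg_min_least[OF fC ne, of w \<rho>] that by (auto simp: z_def)
    have "z \<subset> y" using cmp[of y z] y z by force
    moreover have "y \<in> P" "z \<in> P" using y z C by auto
    ultimately obtain j where j: "j \<in> P" "z \<subseteq> j" "j \<subset> y" "\<rho> j = Suc (\<rho> y)"
      using cover[of y z] by blast
    have "j \<in> C"
    proof (rule ins)
      show "j \<in> P" by fact
      show "x \<subseteq> j" using z C j by blast
      fix w assume w: "w \<in> C"
      show "w \<subseteq> j \<or> j \<subseteq> w"
      proof (cases "\<rho> w \<le> r")
        case True
        then show ?thesis using cmp[of w y] w y j by auto
      next
        case False
        then show ?thesis using cmp[of z w] zmin[of w] w z j by auto
      qed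
    qed
    then show ?case using j y by force
  qed
  have "\<rho> ` C = {..\<rho> x}"
  proof
    show "\<rho> ` C \<subseteq> {..\<rho> x}" using C x rank_mono[of _ x] by auto
    show "{..\<rho> x} \<subseteq> \<rho> ` C" using all by auto
  qed
  moreover have "inj_on \<rho> C" using C by (intro rank_inj_on_chain) auto
  ultimately have "card C = card {..\<rho> x}" by (metis card_image)
  then show "card C = rk_in P rev_incl x + 1" by (simp add: rk_in_eq x)
qed

text \<open>Climb from \<open>m\<close> to \<open>x\<close> through joins with atoms: each of them raises the rank of the
  corresponding join with \<open>y\<close> by at most one, which is submodularity of the rank.\<close>

lemma join_submodular:
  assumes "u \<in> P" "x \<in> P" "y \<in> P" "m \<in> P" "u \<subseteq> x" "x \<subseteq> m" "u \<subseteq> y" "y \<subseteq> m"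
  shows "\<exists>j\<in>P. u \<subseteq> j \<and> j \<subseteq> x \<and> j \<subseteq> y \<and>
    (\<forall>v\<in>P. u \<subseteq> v \<longrightarrow> v \<subseteq> x \<longrightarrow> v \<subseteq> y \<longrightarrow> v \<subseteq> j) \<and> \<rho> j + \<rho> m \<le> \<rho> x + \<rho> y"
  using assms
proof (induction "card {z \<in> P. z \<subset> m}" arbitrary: m y rule: less_induct)
  case less
  show ?case
  proof (cases "x = m")
    case True
    with less.prems show ?thesis by (intro bexI[of _ y]) auto
  next
    case False
    then obtain c where c: "c \<in> At" "x \<subseteq> c" "\<not> m \<subseteq> c"
      using atom_sep[of m x] less.prems by blast
    have uc: "u \<subseteq> c" using less.prems(5) c(2) by (rule subset_trans)
    obtain m' where m': "m' \<in> P" "u \<subseteq> m'" "m' \<subseteq> m" "m' \<subseteq> c" "\<rho> m' = Suc (\<rho> m)"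
      "\<forall>v\<in>P. u \<subseteq> v \<longrightarrow> v \<subseteq> m \<longrightarrow> v \<subseteq> c \<longrightarrow> v \<subseteq> m'"
      using join_atom[OF less.prems(1,4) c(1) subset_trans[OF less.prems(5,6)] uc c(3)] by metis
    have "\<exists>y'\<in>P. u \<subseteq> y' \<and> y' \<subseteq> y \<and> y' \<subseteq> c \<and> \<rho> y' \<le> Suc (\<rho> y) \<and>
        (\<forall>v\<in>P. u \<subseteq> v \<longrightarrow> v \<subseteq> y \<longrightarrow> v \<subseteq> c \<longrightarrow> v \<subseteq> y')"
    proof (cases "y \<subseteq> c")
      case True
      with less.prems show ?thesis by (intro bexI[of _ y]) auto
    next
      case False
      from join_atom[OF less.prems(1) less.prems(3) c(1) less.prems(7) uc False]
      show ?thesis by auto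
    qed
    then obtain y' where y': "y' \<in> P" "u \<subseteq> y'" "y' \<subseteq> y" "y' \<subseteq> c" "\<rho> y' \<le> Suc (\<rho> y)"
      "\<forall>v\<in>P. u \<subseteq> v \<longrightarrow> v \<subseteq> y \<longrightarrow> v \<subseteq> c \<longrightarrow> v \<subseteq> y'" by metis
    have "card {z \<in> P. z \<subset> m'} < card {z \<in> P. z \<subset> m}"
      using m' c fin by (intro psubset_card_mono) auto
    moreover have "x \<subseteq> m'" using m'(6) less.prems(2,5,6) c(2) by metis
    moreover have "y' \<subseteq> m'" using m'(6) less.prems(8) y' by (metis subset_trans)
    ultimately obtain j where j: "j \<in> P" "u \<subseteq> j" "j \<subseteq> x" "j \<subseteq> y'"
      "\<forall>v\<in>P. u \<subseteq> v \<longrightarrow> v \<subseteq> x \<longrightarrow> v \<subseteq> y' \<longrightarrow> v \<subseteq> j" "\<rho> j + \<rho> m' \<le> \<rho> x + \<rho> y'"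
      using less.hyps[of m' y'] less.prems(1,2,5) m'(1) y'(1,2) by metis
    have "v \<subseteq> j" if "v \<in> P" "u \<subseteq> v" "v \<subseteq> x" "v \<subseteq> y" for v
      using j(5) y'(6) that c(2) by (metis subset_trans)
    moreover have "\<rho> j + \<rho> m \<le> \<rho> x + \<rho> y" using j(6) m'(5) y'(5) by linarith
    ultimately show ?thesis using j y' by (intro bexI[of _ j]) auto
  qed
qed

lemma join_exists:
  assumes "u \<in> P" "x \<in> P" "y \<in> P" "u \<subseteq> x" "u \<subseteq> y"
  shows "\<exists>j. is_lub {z \<in> P. u \<subseteq> z} rev_incl {x, y} j"
proof -
  from join_submodular[OF assms(1-3) T_in assms(4) sub_T assms(5) sub_T] assms
  obtain j where "j \<in> P" "u \<subseteq> j" "j \<subseteq> x" "j \<subseteq> y"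
    "\<forall>v\<in>P. u \<subseteq> v \<longrightarrow> v \<subseteq> x \<longrightarrow> v \<subseteq> y \<longrightarrow> v \<subseteq> j" by metis
  then have "is_lub {z \<in> P. u \<subseteq> z} rev_incl {x, y} j" by (simp add: is_lub_rev_incl)
  then show ?thesis ..
qed

text \<open>The common lower bounds of \<open>x\<close> and \<open>y\<close> are closed under joins
  below \<open>u\<close>, because \<open>x\<close> and \<open>y\<close> are themselves upper bounds
  of any two of them. So an inclusion-minimal one is the smallest.\<close>

lemma meet_exists:
  assumes "u \<in> P" "x \<in> P" "y \<in> P" "u \<subseteq> x" "u \<subseteq> y"
  shows "\<exists>m. is_glb {z \<in> P. u \<subseteq> z} rev_incl {x, y} m"
proof -
  define W where "W = {w \<in> P. x \<subseteq> w \<and> y \<subseteq> w}"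
  have "finite W" "W \<noteq> {}" using fin T_in sub_T assms by (auto simp: W_def)
  then obtain m where m: "m \<in> W" "\<forall>w\<in>W. w \<subseteq> m \<longrightarrow> m = w"
    using finite_has_minimal[of W] by blast
  have "m \<subseteq> w" if w: "w \<in> W" for w
  proof -
    have "m \<in> P" "w \<in> P" "u \<subseteq> m" "u \<subseteq> w"
      using m(1) w assms by (auto simp: W_def)
    from join_exists[OF assms(1) this]
    obtain j where j: "is_lub {z \<in> P. u \<subseteq> z} rev_incl {m, w} j" ..
    then have "j \<in> W" "j \<subseteq> m" "j \<subseteq> w"
      using m(1) w assms by (auto simp: W_def is_lub_rev_incl)
    with m(2) show ?thesis by auto
  qed
  moreover have "m \<in> P" "x \<subseteq> m" "y \<subseteq> m" using m(1) by (auto simp: W_def)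
  ultimately have "is_glb {z \<in> P. u \<subseteq> z} rev_incl {x, y} m"
    using assms(4) by (auto simp: is_glb_rev_incl W_def)
  then show ?thesis ..
qed

text \<open>Separating \<open>x\<close> from \<open>T\<close> puts a rank-one \<open>x\<close>
  inside some atom \<open>c\<close>, and strictness of the rank leaves no room between them.
  Conversely the join of \<open>T\<close> with an atom is the atom itself.\<close>

lemma rank_1_iff: "x \<in> P \<Longrightarrow> \<rho> x = 1 \<longleftrightarrow> x \<in> At"
proof
  assume x: "x \<in> P" "\<rho> x = 1"
  then have "x \<subset> T" using rank_T sub_T by force
  then obtain c where c: "c \<in> At" "x \<subseteq> c" using atom_sep[of T x] T_in x by blast
  have "c \<in> P" "c \<subset> T" using c At_sub T_not_At sub_T by (metis subsetD, metis psubsetI subsetD)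
  then have "\<rho> c > 0" using rank_strict[of T c] T_in by simp
  then have "\<not> x \<subset> c" using rank_strict[of c x] x \<open>c \<in> P\<close> by auto
  then show "x \<in> At" using c by blast
next
  assume x: "x \<in> P" "x \<in> At"
  then have "\<not> T \<subseteq> x" using T_not_At sub_T[of x] by (metis subset_antisym)
  then obtain j where "j \<in> P" "x \<subseteq> j" "j \<subseteq> x" "\<rho> j = Suc (\<rho> T)"
    using join_atom[of x T x] x T_in sub_T by blast
  then show "\<rho> x = 1" using rank_T by (metis One_nat_def subset_antisym)
qed

lemma is_atom_iff: "is_atom P rev_incl a \<longleftrightarrow> a \<in> At"
  using rank_1_iff At_sub rk_in_eq unfolding is_atom_def by auto

lemma geometric_below:
  assumes u: "u \<in> P"
  shows "geometric_lattice (below P rev_incl u) rev_incl"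
proof -
  let ?Q = "{z \<in> P. u \<subseteq> z}"
  have rk: "rk_in ?Q rev_incl x = \<rho> x" if "x \<in> ?Q" for x
    using that by (simp add: rk_in_below rk_in_eq)
  have "rk_in ?Q rev_incl (join_in ?Q rev_incl x y) + rk_in ?Q rev_incl (meet_in ?Q rev_incl x y)
      \<le> rk_in ?Q rev_incl x + rk_in ?Q rev_incl y" if xy: "x \<in> ?Q" "y \<in> ?Q" for x y
  proof -
    have xy': "x \<in> P" "y \<in> P" "u \<subseteq> x" "u \<subseteq> y" using xy by auto
    from meet_exists[OF u this] obtain m where m: "is_glb ?Q rev_incl {x, y} m" ..
    then have m': "m \<in> ?Q" "m \<in> P" "x \<subseteq> m" "y \<subseteq> m" by (auto simp: is_glb_rev_incl)
    from join_submodular[OF u xy'(1,2) m'(2) xy'(3) m'(3) xy'(4) m'(4)]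
    obtain j where j: "j \<in> P" "u \<subseteq> j" "j \<subseteq> x" "j \<subseteq> y"
      "\<forall>v\<in>P. u \<subseteq> v \<longrightarrow> v \<subseteq> x \<longrightarrow> v \<subseteq> y \<longrightarrow> v \<subseteq> j" "\<rho> j + \<rho> m \<le> \<rho> x + \<rho> y" by metis
    then have "is_lub ?Q rev_incl {x, y} j" unfolding is_lub_rev_incl by simp
    then show ?thesis
      using m xy j m'(1) by (simp add: join_in_eq meet_in_eq rk)
  qed
  moreover have "is_lub ?Q rev_incl {a \<in> ?Q. is_atom ?Q rev_incl a \<and> rev_incl a y} y"
    if y: "y \<in> ?Q" for y
  proof -
    have least: "w \<subseteq> y" if w: "w \<in> ?Q" "\<And>c. c \<in> At \<Longrightarrow> y \<subseteq> c \<Longrightarrow> w \<subseteq> c" for w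
    proof -
      have "y \<in> P" "w \<in> P" "u \<subseteq> y" "u \<subseteq> w" using y w(1) by auto
      from meet_exists[OF u this] obtain m where m: "is_glb ?Q rev_incl {y, w} m" ..
      \<comment> \<open>Otherwise an atom \<open>c\<close> contains \<open>y\<close> but not the
        meet \<open>m\<close>. Being an atom over \<open>y\<close> it also contains
        \<open>w\<close>, so it is a common lower bound and must contain \<open>m\<close>.\<close>
      have "m = y"
      proof (rule ccontr)
        assume "m \<noteq> y"
        then have "y \<subset> m" "m \<in> P" using m by (auto simp: is_glb_rev_incl)
        then obtain c where c: "c \<in> At" "y \<subseteq> c" "\<not> m \<subseteq> c"
          using atom_sep[of m y] y by auto
        moreover have "w \<subseteq> c" using c w(2) by blast
        moreover have "c \<in> ?Q" using c y At_sub by auto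
        ultimately show False using m by (auto simp: is_glb_rev_incl)
      qed
      then show ?thesis using m by (auto simp: is_glb_rev_incl)
    qed
    have "is_atom ?Q rev_incl a \<longleftrightarrow> a \<in> At \<and> u \<subseteq> a" for a
      using rank_1_iff At_sub rk by (auto simp: is_atom_def)
    then have *: "{a \<in> ?Q. is_atom ?Q rev_incl a \<and> rev_incl a y} = {a \<in> At. y \<subseteq> a}"
      using y At_sub by (auto simp: rev_incl_def)
    show ?thesis
      unfolding * is_lub_rev_incl by (intro conjI ballI impI y least) auto
  qed
  ultimately show ?thesis
    unfolding geometric_lattice_def below_rev_incl is_lattice_def
    using fin partial_order_rev_incl join_exists[OF u] meet_exists[OF u] by simp
qed

end

section \<open>Adjoining sections\<close>

text \<open>Intersecting with one section is enough: where a second section agrees with the first,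
  the condition is already expressed by an atom of \<open>R\<close>.\<close>

definition ext :: "'a set set \<Rightarrow> 'a set set \<Rightarrow> 'a set set" where
  "ext R A = R \<union> {Y \<inter> a |Y a. Y \<in> R \<and> a \<in> A}"

text \<open>\<open>R\<close> should be thought of as a family pulled back along a projection of \<open>T\<close>, and \<open>A\<close>
  as a set of sections of that projection; \<open>sec_coincide\<close> says that near \<open>u\<close> two sections agree
  exactly along one atom of \<open>R\<close>.\<close>

locale sections =
  fixes R :: "'a set set" and T :: "'a set" and At :: "'a set set" and A :: "'a set set"
  assumes fin_A: "finite A"
    and A_sub: "\<And>a. a \<in> A \<Longrightarrow> a \<subseteq> T"
    and sec_proj: "\<And>Y Z a. \<lbrakk>Y \<in> R; Z \<in> R; a \<in> A; Y \<inter> a \<subseteq> Z\<rbrakk> \<Longrightarrow> Y \<subseteq> Z"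
    and not_sub_sec: "\<And>Y a. \<lbrakk>Y \<in> R; a \<in> A\<rbrakk> \<Longrightarrow> \<not> Y \<subseteq> a"
    and sec_coincide: "\<And>a b u. \<lbrakk>a \<in> A; b \<in> A; a \<noteq> b; u \<in> ext R A; u \<subseteq> a; u \<subseteq> b\<rbrakk> \<Longrightarrow>
      \<exists>d\<in>At. u \<subseteq> d \<and> (\<forall>X\<in>ext R A. u \<subseteq> X \<longrightarrow> X \<subseteq> a \<longrightarrow> (X \<subseteq> b \<longleftrightarrow> X \<subseteq> d))"

locale section_extension = layer_poset R T \<rho> At + sections R T At A
  for R :: "'a set set" and T \<rho> At A
begin

abbreviation "P \<equiv> ext R A"

text \<open>The base \<open>Y\<close> of a layer \<open>Y \<inter> a\<close>, written without
  choosing a representation; by \<open>pr_sec\<close> every representation has the same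
  base.\<close>

definition pr :: "'a set \<Rightarrow> 'a set" where
  "pr X = \<Inter>{Z \<in> R. X \<subseteq> Z}"

definition rank' :: "'a set \<Rightarrow> nat" where
  "rank' X = \<rho> (pr X) + (if X \<in> R then 0 else 1)"

lemma R_sub_P: "X \<in> R \<Longrightarrow> X \<in> P"
  by (simp add: ext_def)

lemma sec_in_P: "\<lbrakk>Y \<in> R; a \<in> A\<rbrakk> \<Longrightarrow> Y \<inter> a \<in> P"
  by (auto simp: ext_def)

lemma A_sub_P: "a \<in> A \<Longrightarrow> a \<in> P"
  using sec_in_P[OF T_in, of a] A_sub[of a] by (simp add: Int_absorb1)

lemma sec_notin_R: "\<lbrakk>Y \<in> R; a \<in> A\<rbrakk> \<Longrightarrow> Y \<inter> a \<notin> R"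
  using sec_proj[of Y "Y \<inter> a" a] not_sub_sec[of Y a] by auto

lemma A_notin_R: "a \<in> A \<Longrightarrow> a \<notin> R"
  using not_sub_sec[of a a] by auto

lemma pr_R: "Y \<in> R \<Longrightarrow> pr Y = Y"
  by (auto simp: pr_def)

lemma pr_sec:
  assumes "Y \<in> R" "a \<in> A"
  shows "pr (Y \<inter> a) = Y"
proof -
  have "{Z \<in> R. Y \<inter> a \<subseteq> Z} = {Z \<in> R. Y \<subseteq> Z}"
    using sec_proj[OF assms(1) _ assms(2)] by auto
  then show ?thesis using pr_R[OF assms(1)] by (simp add: pr_def)
qed

lemma P_cases:
  assumes "X \<in> P"
  obtains "X \<in> R" "pr X = X" | a where "a \<in> A" "X \<notin> R" "pr X \<in> R" "X = pr X \<inter> a"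
  using assms pr_R pr_sec sec_notin_R unfolding ext_def by auto

lemma pr_in: "X \<in> P \<Longrightarrow> pr X \<in> R"
  by (erule P_cases) simp_all

lemma pr_sup: "X \<subseteq> pr X"
  by (auto simp: pr_def)

lemma pr_least: "\<lbrakk>Z \<in> R; X \<subseteq> Z\<rbrakk> \<Longrightarrow> pr X \<subseteq> Z"
  by (auto simp: pr_def)

lemma pr_mono: "X \<subseteq> Z \<Longrightarrow> pr X \<subseteq> pr Z"
  by (auto simp: pr_def)

lemma pr_le_iff: "Z \<in> R \<Longrightarrow> pr X \<subseteq> Z \<longleftrightarrow> X \<subseteq> Z"
  using pr_least pr_sup by blast

lemma rank_R: "X \<in> R \<Longrightarrow> rank' X = \<rho> X"
  by (simp add: rank'_def pr_R)

lemma rank_sec: "\<lbrakk>Y \<in> R; a \<in> A\<rbrakk> \<Longrightarrow> rank' (Y \<inter> a) = Suc (\<rho> Y)"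
  by (simp add: rank'_def pr_sec sec_notin_R)

lemma finite_P: "finite P"
proof -
  have "P = R \<union> (\<lambda>(Y, a). Y \<inter> a) ` (R \<times> A)" by (auto simp: ext_def)
  then show ?thesis using fin fin_A by simp
qed

text \<open>Since \<open>u\<close> need not be in \<open>R\<close>, the join is formed below
  \<open>pr u\<close>. Monotonicity of the projection carries its universal property over to all
  \<open>v\<close> in \<open>P\<close>.\<close>

lemma join_atom_R:
  assumes "u \<in> P" "Y \<in> R" "c \<in> At" "u \<subseteq> Y" "u \<subseteq> c" "\<not> Y \<subseteq> c"
  obtains j where "j \<in> R" "u \<subseteq> j" "j \<subseteq> Y" "j \<subseteq> c" "\<rho> j = Suc (\<rho> Y)"
    "\<And>v. \<lbrakk>v \<in> P; u \<subseteq> v; v \<subseteq> Y; v \<subseteq> c\<rbrakk> \<Longrightarrow> v \<subseteq> j"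
proof -
  have c: "c \<in> R" using assms At_sub by blast
  from join_atom[of "pr u" Y c] assms pr_in[of u] pr_least c
  obtain j where j: "j \<in> R" "pr u \<subseteq> j" "j \<subseteq> Y" "j \<subseteq> c" "\<rho> j = Suc (\<rho> Y)"
    "\<forall>v\<in>R. pr u \<subseteq> v \<longrightarrow> v \<subseteq> Y \<longrightarrow> v \<subseteq> c \<longrightarrow> v \<subseteq> j" by metis
  have "v \<subseteq> j" if v: "v \<in> P" "u \<subseteq> v" "v \<subseteq> Y" "v \<subseteq> c" for v
    using j(6) pr_in[OF v(1)] pr_mono[OF v(2)] pr_least[OF assms(2) v(3)] pr_least[OF c v(4)]
      pr_sup[of v] by (metis subset_trans)
  moreover have "u \<subseteq> j" using pr_sup[of u] j(2) by (rule subset_trans)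
  ultimately show ?thesis using that j by metis
qed

lemma ext_layer_poset: "layer_poset P T rank' (At \<union> A)"
proof
  show "finite P" by (rule finite_P)
  show "T \<in> P" by (rule R_sub_P[OF T_in])
  show "x \<subseteq> T" if "x \<in> P" for x
    using that sub_T by (auto simp: ext_def)
  show "rank' T = 0" using rank_R T_in rank_T by simp
  show "At \<union> A \<subseteq> P" using At_sub R_sub_P A_sub_P by blast
  show "T \<notin> At \<union> A" using T_not_At A_notin_R T_in by blast
next
  fix u x c
  assume u: "u \<in> P" and x: "x \<in> P" and c: "c \<in> At \<union> A" and ux: "u \<subseteq> x" and uc: "u \<subseteq> c"
    and nxc: "\<not> x \<subseteq> c"
  show "\<exists>j\<in>P. u \<subseteq> j \<and> j \<subseteq> x \<and> j \<subseteq> c \<and> rank' j = Suc (rank' x) \<and>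
        (\<forall>v\<in>P. u \<subseteq> v \<longrightarrow> v \<subseteq> x \<longrightarrow> v \<subseteq> c \<longrightarrow> v \<subseteq> j)"
  proof (cases "c \<in> A")
    case cA: True
    show ?thesis
    proof (cases rule: P_cases[OF x])
      case 1
      show ?thesis
        using 1 cA u ux uc by (intro bexI[of _ "x \<inter> c"]) (auto simp: rank_sec rank_R sec_in_P)
    next
      case (2 a)
      have "a \<noteq> c" "u \<subseteq> a" using 2 nxc ux by auto
      \<comment> \<open>Inside \<open>a\<close>, lying in the section \<open>c\<close> is equivalent
        to lying in the atom \<open>d\<close> of \<open>R\<close>. The join of \<open>x\<close> with
        \<open>c\<close> is thus the join of its base with \<open>d\<close>, cut by
        \<open>a\<close>.\<close>
      from sec_coincide[OF 2(1) cA this(1) u this(2) uc]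
      obtain d where d: "d \<in> At" "u \<subseteq> d"
        and dc: "\<And>X. \<lbrakk>X \<in> P; u \<subseteq> X; X \<subseteq> a\<rbrakk> \<Longrightarrow> X \<subseteq> c \<longleftrightarrow> X \<subseteq> d" by metis
      have xa: "x \<subseteq> a" using 2 by auto
      have "\<not> x \<subseteq> d" using dc[OF x ux xa] nxc by simp
      then have np: "\<not> pr x \<subseteq> d" using pr_sup by (metis subset_trans)
      have "u \<subseteq> pr x" using ux pr_sup by (rule subset_trans)
      from join_atom_R[OF u 2(3) d(1) this d(2) np]
      obtain j where j: "j \<in> R" "u \<subseteq> j" "j \<subseteq> pr x" "j \<subseteq> d" "\<rho> j = Suc (\<rho> (pr x))"
        "\<And>v. \<lbrakk>v \<in> P; u \<subseteq> v; v \<subseteq> pr x; v \<subseteq> d\<rbrakk> \<Longrightarrow> v \<subseteq> j" by metis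
      show ?thesis
      proof (intro bexI[of _ "j \<inter> a"] conjI ballI impI)
        show ja: "j \<inter> a \<in> P" using j 2 sec_in_P by blast
        show uj: "u \<subseteq> j \<inter> a" using j \<open>u \<subseteq> a\<close> by simp
        have "j \<inter> a \<subseteq> pr x \<inter> a" using j(3) by auto
        then show "j \<inter> a \<subseteq> x" using 2(4) by simp
        show "j \<inter> a \<subseteq> c" using dc[OF ja uj] j(4) by auto
        show "rank' (j \<inter> a) = Suc (rank' x)"
          using j(1,5) 2(1,2) by (simp add: rank_sec rank'_def[of x])
        fix v assume v: "v \<in> P" "u \<subseteq> v" "v \<subseteq> x" "v \<subseteq> c"
        have va: "v \<subseteq> a" using v(3) xa by (rule subset_trans)
        then have "v \<subseteq> d" using dc v by simp
        moreover have "v \<subseteq> pr x" using v(3) pr_sup by (rule subset_trans)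
        ultimately show "v \<subseteq> j \<inter> a" using j(6) v va by simp
      qed
    qed
  next
    case False
    then have cAt: "c \<in> At" using c by blast
    have up: "u \<subseteq> pr x" using ux pr_sup by (rule subset_trans)
    have np: "\<not> pr x \<subseteq> c" using nxc pr_sup by (metis subset_trans)
    from join_atom_R[OF u pr_in[OF x] cAt up uc np]
    obtain j where j: "j \<in> R" "u \<subseteq> j" "j \<subseteq> pr x" "j \<subseteq> c" "\<rho> j = Suc (\<rho> (pr x))"
      "\<And>v. \<lbrakk>v \<in> P; u \<subseteq> v; v \<subseteq> pr x; v \<subseteq> c\<rbrakk> \<Longrightarrow> v \<subseteq> j" by metis
    have jv: "v \<subseteq> j" if v: "v \<in> P" "u \<subseteq> v" "v \<subseteq> x" "v \<subseteq> c" for v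
      using j(6)[OF v(1,2) _ v(4)] v(3) pr_sup[of x] by (metis subset_trans)
    show ?thesis
    proof (cases rule: P_cases[OF x])
      case 1
      show ?thesis
      proof (intro bexI[of _ j] conjI ballI impI)
        show "j \<subseteq> x" using j(3) 1 by simp
        show "rank' j = Suc (rank' x)" using j(1,5) 1 by (simp add: rank_R)
      qed (use j jv R_sub_P in \<open>assumption | simp\<close>)+
    next
      case (2 a)
      have xa: "x \<subseteq> a" using 2 by auto
      show ?thesis
      proof (intro bexI[of _ "j \<inter> a"] conjI ballI impI)
        show "j \<inter> a \<in> P" using j 2 sec_in_P by blast
        show "u \<subseteq> j \<inter> a" using j(2) ux xa by (metis Int_greatest subset_trans)
        have "j \<inter> a \<subseteq> pr x \<inter> a" using j(3) by auto
        then show "j \<inter> a \<subseteq> x" using 2(4) by simp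
        show "j \<inter> a \<subseteq> c" using j(4) by auto
        show "rank' (j \<inter> a) = Suc (rank' x)"
          using j(1,5) 2(1,2) by (simp add: rank_sec rank'_def[of x])
        fix v assume v: "v \<in> P" "u \<subseteq> v" "v \<subseteq> x" "v \<subseteq> c"
        then show "v \<subseteq> j \<inter> a" using jv[OF v] xa by (metis Int_greatest subset_trans)
      qed
    qed
  qed
next
  fix x y assume x: "x \<in> P" and y: "y \<in> P" and yx: "y \<subset> x"
  show "\<exists>c\<in>At \<union> A. y \<subseteq> c \<and> \<not> x \<subseteq> c"
  proof (cases "pr x = pr y")
    case True
    show ?thesis
    proof (cases rule: P_cases[OF y])
      case 1
      then have False using True yx pr_sup[of x] by auto
      then show ?thesis ..
    next
      case (2 a)
      have "\<not> x \<subseteq> a"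
      proof
        assume "x \<subseteq> a"
        then have "x \<subseteq> pr y \<inter> a" using True pr_sup[of x] by simp
        then show False using 2(4) yx by simp
      qed
      then show ?thesis using 2 by auto
    qed
  next
    case False
    then have "pr y \<subset> pr x" using pr_mono[of y x] yx by auto
    then obtain c where c: "c \<in> At" "pr y \<subseteq> c" "\<not> pr x \<subseteq> c"
      using atom_sep[of "pr x" "pr y"] pr_in x y by blast
    moreover have "c \<in> R" using c At_sub by blast
    ultimately show ?thesis by (meson UnI1 pr_le_iff)
  qed
qed

text \<open>A member of \<open>R\<close> can still be cut by any section, so it is not maximal; and
  a proper shrinking \<open>y\<close> of the base would shrink the layer to
  \<open>y \<inter> a\<close>.\<close>

lemma maximal_ext:
  assumes "A \<noteq> {}" "maximal_in P rev_incl x"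
  shows "x \<notin> R" "maximal_in R rev_incl (pr x)"
proof -
  obtain a0 where a0: "a0 \<in> A" using assms(1) by blast
  have x: "x \<in> P" and max: "\<And>y. y \<in> P \<Longrightarrow> y \<subseteq> x \<Longrightarrow> y = x"
    using assms(2) by (auto simp: maximal_rev_incl)
  show nR: "x \<notin> R"
  proof
    assume "x \<in> R"
    then show False
      using max[OF sec_in_P[OF _ a0, of x]] sec_notin_R[OF _ a0, of x] by auto
  qed
  then obtain a where a: "a \<in> A" "x = pr x \<inter> a" "pr x \<in> R"
    using P_cases[OF x] by metis
  have "y = pr x" if y: "y \<in> R" "y \<subseteq> pr x" for y
  proof -
    have "y \<inter> a \<subseteq> pr x \<inter> a" using y by auto
    then have "y \<inter> a = x" using max[OF sec_in_P[OF y(1) a(1)]] a(2) by simp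
    then show ?thesis using pr_sec[OF y(1) a(1)] by simp
  qed
  then show "maximal_in R rev_incl (pr x)"
    using a(3) by (simp add: maximal_rev_incl)
qed

text \<open>No section contains a member of \<open>R\<close>, so everything over \<open>pr x\<close>
  lies in \<open>R\<close> and the meet of \<open>pr x\<close> with \<open>v\<close> is
  \<open>pr v\<close>. The modular law then says that projecting the join of \<open>w\<close> and
  \<open>z\<close> gives the join of \<open>pr w\<close> and \<open>z\<close>, for \<open>z\<close>
  in \<open>R\<close>.\<close>

lemma modular_pr:
  assumes x: "x \<in> P"
  shows "modular_elem (below P rev_incl x) rev_incl (pr x)"
  unfolding modular_elem_def below_rev_incl rev_incl_def[of _ "pr x"]
proof (intro conjI ballI impI)
  let ?Q = "{z \<in> P. x \<subseteq> z}"
  interpret ext: layer_poset P T rank' "At \<union> A" by (rule ext_layer_poset)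
  show "pr x \<in> ?Q" using x pr_sup R_sub_P pr_in by simp
  fix w z assume w: "w \<in> ?Q" and z: "z \<in> ?Q" and zx: "pr x \<subseteq> z"
  have zR: "z \<in> R"
  proof (rule ccontr)
    assume "z \<notin> R"
    moreover have "z \<in> P" using z by simp
    ultimately obtain a where "a \<in> A" "z = pr z \<inter> a" using P_cases[of z] by metis
    then show False using not_sub_sec[OF pr_in[OF x], of a] zx by auto
  qed
  have meet: "is_glb ?Q rev_incl {pr x, v} (pr v)" if v: "v \<in> ?Q" for v
    unfolding is_glb_rev_incl
  proof (intro conjI ballI impI)
    show "pr v \<in> ?Q" using v pr_sup[of v] R_sub_P pr_in by auto
    show "s \<subseteq> pr v" if "s \<in> {pr x, v}" for s
      using that v pr_mono[of x v] pr_sup[of v] by auto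
    fix y assume y: "y \<in> ?Q" "\<forall>s\<in>{pr x, v}. s \<subseteq> y"
    show "pr v \<subseteq> y"
    proof (cases "y \<in> R")
      case True
      then show ?thesis using y pr_least by auto
    next
      case False
      moreover have "y \<in> P" using y by simp
      ultimately obtain a where "a \<in> A" "y = pr y \<inter> a" using P_cases[of y] by metis
      then show ?thesis using not_sub_sec[OF pr_in[OF x], of a] y(2) by auto
    qed
  qed
  have w': "w \<in> P" "x \<subseteq> w" "x \<subseteq> pr w" "pr w \<in> P" "pr w \<in> R"
    using w pr_sup[of w] R_sub_P pr_in by auto
  have z': "z \<in> P" "x \<subseteq> z" using z by auto
  from ext.join_exists[OF x w'(4) z'(1) w'(3) z'(2)]
  obtain j where j: "is_lub ?Q rev_incl {pr w, z} j" ..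
  \<comment> \<open>Both joined elements lie in \<open>R\<close>, so \<open>pr j\<close> is an upper
    bound of them as well, and leastness of \<open>j\<close> gives \<open>pr j = j\<close>.\<close>
  have jR: "j \<in> R"
  proof -
    have "pr j \<in> ?Q" "pr j \<subseteq> pr w" "pr j \<subseteq> z"
      using j pr_sup[of j] R_sub_P pr_in w'(5) zR pr_least by (auto simp: is_lub_rev_incl)
    then have "pr j \<subseteq> j" using j by (auto simp: is_lub_rev_incl)
    then have "pr j = j" using pr_sup by auto
    then show ?thesis using pr_in[of j] j by (auto simp: is_lub_rev_incl)
  qed
  obtain k where k: "is_lub ?Q rev_incl {w, z} k" "pr k = j"
  proof (cases rule: P_cases[OF w'(1)])
    case 1
    then show ?thesis using that[of j] j jR pr_R by simp
  next
    case (2 a)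
    have wa: "w \<subseteq> a" using 2(4) by auto
    have "is_lub ?Q rev_incl {w, z} (j \<inter> a)"
      unfolding is_lub_rev_incl
    proof (intro conjI ballI impI)
      have jw: "j \<subseteq> pr w" "j \<subseteq> z" "x \<subseteq> j" using j by (auto simp: is_lub_rev_incl)
      show "j \<inter> a \<in> ?Q" using sec_in_P[OF jR 2(1)] jw(3) w'(2) wa by auto
      have "j \<inter> a \<subseteq> pr w \<inter> a" using jw by auto
      then have "j \<inter> a \<subseteq> w" using 2(4) by simp
      then show "j \<inter> a \<subseteq> s" if "s \<in> {w, z}" for s using that jw(2) by auto
      fix v assume v: "v \<in> ?Q" "\<forall>s\<in>{w, z}. v \<subseteq> s"
      then have "v \<subseteq> w" "v \<subseteq> z" by auto
      then have "v \<subseteq> pr w" using pr_sup[of w] by auto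
      then have "v \<subseteq> j" using j v(1) \<open>v \<subseteq> z\<close> by (auto simp: is_lub_rev_incl)
      then show "v \<subseteq> j \<inter> a" using \<open>v \<subseteq> w\<close> wa by auto
    qed
    then show ?thesis using that pr_sec[OF jR 2(1)] by metis
  qed
  have kQ: "k \<in> ?Q" using k by (auto simp: is_lub_rev_incl)
  show "meet_in ?Q rev_incl (pr x) (join_in ?Q rev_incl w z)
      = join_in ?Q rev_incl (meet_in ?Q rev_incl (pr x) w) z"
    using join_in_eq[OF k(1)] meet_in_eq[OF meet[OF kQ]] meet_in_eq[OF meet[OF w]]
      join_in_eq[OF j] k(2) by simp
qed

text \<open>An atom outside \<open>R\<close> is a section \<open>a\<close>, and
  \<open>y \<inter> a\<close> is itself a layer, so it is the only minimal upper bound.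
  Join-closedness holds because the projection of an upper bound of a subset of \<open>R\<close> is
  again one. The modular element below \<open>x\<close> is \<open>pr x\<close>.\<close>

lemma TM_ideal_R:
  assumes "A \<noteq> {}" and pure: "\<And>y. maximal_in R rev_incl y \<Longrightarrow> \<rho> y = k"
  shows "TM_ideal P rev_incl R"
  unfolding TM_ideal_def
proof (intro conjI allI impI)
  interpret ext: layer_poset P T rank' "At \<union> A" by (rule ext_layer_poset)
  show "order_ideal P rev_incl R"
    unfolding order_ideal_def rev_incl_def
  proof (intro conjI ballI impI)
    show "R \<subseteq> P" using R_sub_P by blast
    fix y z assume y: "y \<in> R" and z: "z \<in> P" "y \<subseteq> z"
    show "z \<in> R"
    proof (rule ccontr)
      assume "z \<notin> R"
      then obtain a where "a \<in> A" "z = pr z \<inter> a" using P_cases[OF z(1)] by metis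
      then show False using not_sub_sec[OF y, of a] z by auto
    qed
  qed
  show "rk_in P rev_incl y1 = rk_in P rev_incl y2"
    if "maximal_in R rev_incl y1 \<and> maximal_in R rev_incl y2" for y1 y2
    using that pure R_sub_P rank_R by (simp add: maximal_rev_incl ext.rk_in_eq)
  show "mubs P rev_incl S \<subseteq> R" if S: "S \<subseteq> R" for S
  proof
    fix v assume v: "v \<in> mubs P rev_incl S"
    then have vP: "v \<in> P" and vS: "\<And>s. s \<in> S \<Longrightarrow> v \<subseteq> s"
      and min: "\<And>w. \<lbrakk>w \<in> P; \<And>s. s \<in> S \<Longrightarrow> w \<subseteq> s\<rbrakk> \<Longrightarrow> \<not> v \<subset> w"
      unfolding mubs_def is_upper_bound_def rev_incl_def lt_in_def by blast+
    have "pr v \<subseteq> s" if "s \<in> S" for s using pr_least[of s v] vS S that by auto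
    then have "\<not> v \<subset> pr v" using min[of "pr v"] R_sub_P pr_in vP by blast
    then have "pr v = v" using pr_sup[of v] by auto
    then show "v \<in> R" using pr_in[OF vP] by simp
  qed
  have mub: "mubs P rev_incl {a, y} = {y \<inter> a}" if "a \<in> A" "y \<in> R" for a y
    using sec_in_P[OF that(2,1)]
    by (auto simp: mubs_def is_upper_bound_def rev_incl_def lt_in_def)
  fix a y assume "is_atom P rev_incl a \<and> a \<notin> R \<and> y \<in> R"
  then have "a \<in> A" "y \<in> R" using ext.is_atom_iff At_sub by auto
  then show "card (mubs P rev_incl {a, y}) = 1" "finite (mubs P rev_incl {a, y})"
    using mub by auto
next
  fix x assume x: "maximal_in P rev_incl x"
  then have "maximal_in R rev_incl (pr x)" "x \<in> P"
    using maximal_ext[OF assms(1)] by (auto simp: maximal_rev_incl)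
  then show "\<exists>y. maximal_in R rev_incl y \<and> rev_incl y x \<and> modular_elem (below P rev_incl x) rev_incl y"
    using modular_pr pr_sup unfolding rev_incl_def[of _ x] by blast
qed

end

section \<open>Characteristic polynomials\<close>

text \<open>The summation form of the Mobius function from \<open>T\<close>: its sum over each
  interval vanishes except at \<open>T\<close>. The value 0 outside \<open>P\<close> matches the
  default in \<open>mobius\<close>.\<close>

definition is_mobius :: "'a set set \<Rightarrow> 'a set \<Rightarrow> ('a set \<Rightarrow> int) \<Rightarrow> bool" where
  "is_mobius P T m \<longleftrightarrow>
     (\<forall>y\<in>P. (\<Sum>z\<in>{z \<in> P. y \<subseteq> z}. m z) = (if y = T then 1 else 0)) \<and> (\<forall>y. y \<notin> P \<longrightarrow> m y = 0)"

lemma mobius_eq: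
  assumes fin: "finite P" and T: "T \<in> P" and sub: "\<And>x. x \<in> P \<Longrightarrow> x \<subseteq> T" and m: "is_mobius P T m"
  shows "mobius P rev_incl T = m"
proof -
  have strict: "{z \<in> P. rev_incl T z \<and> lt_in rev_incl z y} = {z \<in> P. y \<subset> z}" for y
    using sub by (auto simp: rev_incl_def lt_in_def)
  have rec: "m y = - (\<Sum>z\<in>{z \<in> P. y \<subset> z}. m z)" if y: "y \<in> P" "y \<noteq> T" for y
  proof -
    have "{z \<in> P. y \<subseteq> z} = insert y {z \<in> P. y \<subset> z}" using y by auto
    then have "(\<Sum>z\<in>{z \<in> P. y \<subseteq> z}. m z) = m y + (\<Sum>z\<in>{z \<in> P. y \<subset> z}. m z)"
      using fin by simp
    then show ?thesis using m y by (simp add: is_mobius_def)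
  qed
  have "{z \<in> P. T \<subseteq> z} = {T}" using T sub by auto
  moreover have "(\<Sum>z\<in>{z \<in> P. T \<subseteq> z}. m z) = 1" using m T by (simp add: is_mobius_def)
  ultimately have mT: "m T = 1" by simp
  show ?thesis
    unfolding mobius_def strict
  proof (rule the_equality, goal_cases)
    case 1
    show ?case
      using mT rec sub m by (auto simp: is_mobius_def rev_incl_def)
  next
    case (2 m')
    show "m' = m"
    proof
      fix y
      show "m' y = m y"
      proof (cases "y \<in> P")
        case False
        then show ?thesis using 2 m by (simp add: is_mobius_def)
      next
        case True
        then show ?thesis
        proof (induction "card {z \<in> P. y \<subset> z}" arbitrary: y rule: less_induct)
          case less
          show ?case
          proof (cases "y = T")
            case False
            have "m' z = m z" if z: "z \<in> {z \<in> P. y \<subset> z}" for z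
            proof (rule less.hyps)
              show "card {w \<in> P. z \<subset> w} < card {w \<in> P. y \<subset> w}"
                using z fin by (intro psubset_card_mono) auto
            qed (use z in simp)
            then have "(\<Sum>z\<in>{z \<in> P. y \<subset> z}. m' z) = (\<Sum>z\<in>{z \<in> P. y \<subset> z}. m z)"
              by (rule sum.cong[OF refl])
            moreover have "rev_incl T y" using sub less.prems by (simp add: rev_incl_def)
            ultimately show ?thesis using rec[OF less.prems False] 2 less.prems False by simp
          qed (use 2 mT in simp)
        qed
      qed
    qed
  qed
qed

context section_extension
begin

text \<open>The atom \<open>d\<close> along which \<open>a\<close> and \<open>b\<close> agree
  contains \<open>Y \<inter> b\<close>. By \<open>sec_proj\<close> it then contains all of
  \<open>Y\<close>, so the two sections agree over the whole of \<open>Y\<close>.\<close>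

lemma sec_unique:
  assumes Y: "Y \<in> R" and a: "a \<in> A" and b: "b \<in> A" and sub: "Y \<inter> b \<subseteq> a"
  shows "Y \<inter> a = Y \<inter> b"
proof (cases "a = b")
  case False
  have "Y \<inter> b \<subseteq> b" by simp
  from sec_coincide[OF a b False sec_in_P[OF Y b] sub this]
  obtain d where d: "d \<in> At" "Y \<inter> b \<subseteq> d"
    and dX: "\<And>X. \<lbrakk>X \<in> P; Y \<inter> b \<subseteq> X; X \<subseteq> a\<rbrakk> \<Longrightarrow> X \<subseteq> b \<longleftrightarrow> X \<subseteq> d" by metis
  have "Y \<subseteq> d" using sec_proj[OF Y _ b d(2)] d(1) At_sub by auto
  then have "Y \<inter> a \<subseteq> b" using dX[OF sec_in_P[OF Y a]] sub by auto
  then show ?thesis using sub by auto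
qed simp

text \<open>Double counting of the pairs \<open>(X, a)\<close> with \<open>X \<subseteq> a\<close>:
  they correspond to pairs \<open>(Z, a)\<close> through \<open>X = Z \<inter> a\<close> and
  \<open>Z = pr X\<close>. That \<open>a\<close> and \<open>Z\<close> determine \<open>X\<close>,
  whatever section represents it, is \<open>sec_unique\<close>.\<close>

lemma sum_sections:
  fixes g :: "'a set \<Rightarrow> 'b::comm_ring_1"
  shows "(\<Sum>X\<in>{X \<in> P - R. y \<subseteq> X}. of_nat (card {a \<in> A. X \<subseteq> a}) * g (pr X))
    = of_nat (card {a \<in> A. y \<subseteq> a}) * (\<Sum>Z\<in>{Z \<in> R. y \<subseteq> Z}. g Z)"
proof -
  have "(\<Sum>X\<in>{X \<in> P - R. y \<subseteq> X}. of_nat (card {a \<in> A. X \<subseteq> a}) * g (pr X))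
      = (\<Sum>X\<in>{X \<in> P - R. y \<subseteq> X}. \<Sum>a\<in>{a \<in> A. X \<subseteq> a}. g (pr X))"
    by simp
  also have "\<dots> = (\<Sum>(X, a)\<in>(SIGMA X:{X \<in> P - R. y \<subseteq> X}. {a \<in> A. X \<subseteq> a}). g (pr X))"
    using finite_P fin_A by (subst sum.Sigma) auto
  also have "\<dots> = (\<Sum>(Z, a)\<in>{Z \<in> R. y \<subseteq> Z} \<times> {a \<in> A. y \<subseteq> a}. g Z)"
  proof (rule sum.reindex_bij_witness[of _ "\<lambda>(Z, a). (Z \<inter> a, a)" "\<lambda>(X, a). (pr X, a)"], goal_cases)
    case (1 p)
    then obtain X a where p: "p = (X, a)" "X \<in> P" "X \<notin> R" "y \<subseteq> X" "a \<in> A" "X \<subseteq> a" by auto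
    then obtain b where b: "b \<in> A" "X = pr X \<inter> b" "pr X \<in> R" using P_cases[of X] by metis
    then have "pr X \<inter> a = X" using sec_unique[of "pr X" a b] p by simp
    then show ?case using p by simp
  next
    case (2 p)
    then show ?case using pr_sup pr_in by (auto simp: subset_iff)
  next
    case (3 p)
    then show ?case using pr_sec by auto
  next
    case (4 p)
    then show ?case using sec_in_P sec_notin_R by auto
  next
    case (5 p)
    then show ?case by auto
  qed
  also have "\<dots> = (\<Sum>Z\<in>{Z \<in> R. y \<subseteq> Z}. \<Sum>a\<in>{a \<in> A. y \<subseteq> a}. g Z)"
    by (rule sum.cartesian_product[symmetric])
  finally show ?thesis by (simp add: sum_distrib_left)
qed

text \<open>Every section passes through exactly one layer over a given \<open>Y \<in> R\<close>, so these weights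
  add up to \<open>- card A * m Y\<close> over \<open>Y\<close>: adjoining \<open>A\<close> multiplies the characteristic polynomial
  by \<open>t - card A\<close>.\<close>

definition ext_mobius :: "('a set \<Rightarrow> int) \<Rightarrow> 'a set \<Rightarrow> int" where
  "ext_mobius m X = (if X \<in> R then m X else if X \<in> P then - int (card {a \<in> A. X \<subseteq> a}) * m (pr X) else 0)"

lemma sum_P_split:
  fixes f :: "'a set \<Rightarrow> 'b::comm_monoid_add"
  shows "(\<Sum>X\<in>{X \<in> P. y \<subseteq> X}. f X) = (\<Sum>X\<in>{X \<in> R. y \<subseteq> X}. f X) + (\<Sum>X\<in>{X \<in> P - R. y \<subseteq> X}. f X)"
proof -
  have "{X \<in> P. y \<subseteq> X} = {X \<in> R. y \<subseteq> X} \<union> {X \<in> P - R. y \<subseteq> X}" using R_sub_P by auto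
  then show ?thesis using fin finite_P by (simp add: sum.union_disjoint disjoint_iff)
qed

text \<open>The total at \<open>y\<close> is \<open>1 - card {a \<in> A. y \<subseteq> a}\<close> if
  \<open>pr y = T\<close> and 0 otherwise. Over the base \<open>T\<close> there are only
  \<open>T\<close>, which lies on no section, and the sections themselves, each of which lies on
  exactly one.\<close>

lemma is_mobius_ext:
  assumes m: "is_mobius R T m"
  shows "is_mobius P T (ext_mobius m)"
  unfolding is_mobius_def
proof (intro conjI ballI allI impI)
  fix y assume y: "y \<in> P"
  have "{Z \<in> R. y \<subseteq> Z} = {Z \<in> R. pr y \<subseteq> Z}" using pr_le_iff by auto
  then have R: "(\<Sum>Z\<in>{Z \<in> R. y \<subseteq> Z}. m Z) = (if pr y = T then 1 else 0)"
    using m pr_in[OF y] by (simp add: is_mobius_def)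
  have "(\<Sum>X\<in>{X \<in> P. y \<subseteq> X}. ext_mobius m X)
      = (\<Sum>Z\<in>{Z \<in> R. y \<subseteq> Z}. m Z)
        - (\<Sum>X\<in>{X \<in> P - R. y \<subseteq> X}. int (card {a \<in> A. X \<subseteq> a}) * m (pr X))"
    unfolding sum_P_split by (simp add: ext_mobius_def sum_negf cong: sum.cong_simp)
  also have "\<dots> = (1 - int (card {a \<in> A. y \<subseteq> a})) * (if pr y = T then 1 else 0)"
    unfolding sum_sections R by (simp add: algebra_simps)
  also have "\<dots> = (if y = T then 1 else 0)"
  proof (cases rule: P_cases[OF y])
    case 1
    then have none: "{a \<in> A. y \<subseteq> a} = {}" using not_sub_sec by auto
    show ?thesis unfolding none using 1 by simp
  next
    case (2 a)
    have "y \<noteq> T" using 2(2) T_in by auto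
    moreover have "card {b \<in> A. y \<subseteq> b} = 1" if "pr y = T"
    proof -
      have ya: "y = a" using 2(4) that A_sub[OF 2(1)] by auto
      have "b = a" if b: "b \<in> A" "y \<subseteq> b" for b
        using sec_unique[OF T_in b(1) 2(1)] b ya A_sub[OF b(1)] A_sub[OF 2(1)] by auto
      then have "{b \<in> A. y \<subseteq> b} = {a}" using 2(1) ya by auto
      then show ?thesis by simp
    qed
    ultimately show ?thesis by simp
  qed
  finally show "(\<Sum>X\<in>{X \<in> P. y \<subseteq> X}. ext_mobius m X) = (if y = T then 1 else 0)" .
next
  fix y assume "y \<notin> P"
  then show "ext_mobius m y = 0" using R_sub_P by (auto simp: ext_mobius_def)
qed

text \<open>Old layers keep their monomials. The new layers over \<open>Y\<close> have one dimension
  less and total weight \<open>- card A * m Y\<close>, hence the second sum at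
  \<open>N - 1\<close>.\<close>

lemma char_sum_ext:
  "(\<Sum>X\<in>P. monom (ext_mobius m X) (N - rank' X))
    = (\<Sum>Y\<in>R. monom (m Y) (N - \<rho> Y)) - of_nat (card A) * (\<Sum>Y\<in>R. monom (m Y) (N - 1 - \<rho> Y))"
proof -
  \<comment> \<open>The vacuous condition \<open>{} \<subseteq> X\<close> brings the index set into
    the form used by \<open>sum_P_split\<close> and \<open>sum_sections\<close>, at
    \<open>y = {}\<close>.\<close>
  have sec: "monom (ext_mobius m X) (N - rank' X)
      = - (of_nat (card {a \<in> A. X \<subseteq> a}) * monom (m (pr X)) (N - 1 - \<rho> (pr X)))"
    if "X \<in> {X \<in> P - R. {} \<subseteq> X}" for X
    using that by (simp add: ext_mobius_def rank'_def minus_monom of_nat_poly smult_monom)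
  have "(\<Sum>X\<in>P. monom (ext_mobius m X) (N - rank' X))
      = (\<Sum>Y\<in>R. monom (ext_mobius m Y) (N - rank' Y))
        + (\<Sum>X\<in>{X \<in> P - R. {} \<subseteq> X}. monom (ext_mobius m X) (N - rank' X))"
    using sum_P_split[of "\<lambda>X. monom (ext_mobius m X) (N - rank' X)" "{}"] by simp
  also have "(\<Sum>Y\<in>R. monom (ext_mobius m Y) (N - rank' Y)) = (\<Sum>Y\<in>R. monom (m Y) (N - \<rho> Y))"
    by (rule sum.cong) (simp_all add: ext_mobius_def rank_R)
  also have "(\<Sum>X\<in>{X \<in> P - R. {} \<subseteq> X}. monom (ext_mobius m X) (N - rank' X))
      = - (\<Sum>X\<in>{X \<in> P - R. {} \<subseteq> X}.
            of_nat (card {a \<in> A. X \<subseteq> a}) * monom (m (pr X)) (N - 1 - \<rho> (pr X)))"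
    unfolding sum_negf[symmetric] by (rule sum.cong[OF refl sec])
  also have "\<dots> = - (of_nat (card A) * (\<Sum>Y\<in>R. monom (m Y) (N - 1 - \<rho> Y)))"
    by (subst sum_sections[of "\<lambda>Z. monom (m Z) (N - 1 - \<rho> Z)"]) simp
  finally show ?thesis by simp
qed

end

section \<open>Iterating the extension: towers and their exponents\<close>

lemma (in layer_poset) rk_poset_eq:
  assumes pure: "\<And>y. maximal_in P rev_incl y \<Longrightarrow> \<rho> y = k"
  shows "rk_poset P rev_incl = k"
proof -
  have *: "\<exists>y. maximal_in P rev_incl y \<and> y \<subseteq> x" if x: "x \<in> P" for x
  proof -
    obtain y where "y \<in> P" "y \<subseteq> x" "\<forall>z\<in>P. z \<subseteq> y \<longrightarrow> z = y"
      using finite_has_minimal2[OF fin x] by metis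
    then show ?thesis by (auto simp: maximal_rev_incl)
  qed
  have "rk_in P rev_incl ` P = \<rho> ` P" by (simp add: rk_in_eq)
  moreover have "Max (\<rho> ` P) = k"
  proof (rule Max_eqI)
    show "finite (\<rho> ` P)" using fin by simp
    show "r \<le> k" if r: "r \<in> \<rho> ` P" for r
    proof -
      obtain x where "x \<in> P" "r = \<rho> x" using r by auto
      then show ?thesis using *[of x] rank_mono[of x] pure by (metis maximal_rev_incl)
    qed
    show "k \<in> \<rho> ` P" using *[OF T_in] pure by (metis imageI maximal_rev_incl)
  qed
  ultimately show ?thesis by (simp add: rk_poset_def)
qed

definition TM_chain :: "'a set set \<Rightarrow> 'a set \<Rightarrow> nat \<Rightarrow> bool" where
  "TM_chain P T k \<longleftrightarrow> (\<exists>Qs. Qs 0 = {T} \<and> Qs k = P \<and>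
     (\<forall>i<k. Qs i \<subset> Qs (Suc i) \<and> TM_ideal (Qs (Suc i)) rev_incl (Qs i)) \<and>
     (\<forall>i\<le>k. rk_poset (Qs i) rev_incl = i))"

text \<open>The invariant of the induction over rows. The ambient dimension \<open>N\<close> stays
  free because the step from \<open>ds\<close> to a larger multiset evaluates the polynomial
  identity at both \<open>N\<close> and \<open>N - 1\<close>. The rank equals
  \<open>size ds\<close>, as only nonempty rows contribute.\<close>

definition tower :: "'a set set \<Rightarrow> 'a set \<Rightarrow> 'a set set \<Rightarrow> nat multiset \<Rightarrow> bool" where
  "tower P T At ds \<longleftrightarrow> (\<exists>\<rho> m. layer_poset P T \<rho> At \<and>
     (\<forall>y. maximal_in P rev_incl y \<longrightarrow> \<rho> y = size ds) \<and>
     TM_chain P T (size ds) \<and> is_mobius P T m \<and>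
     (\<forall>N \<ge> size ds. (\<Sum>X\<in>P. monom (m X) (N - \<rho> X)) = monom 1 (N - size ds) * (\<Prod>d\<in>#ds. [:- int d, 1:])) \<and>
     (\<forall>d\<in>#ds. 0 < d))"

lemma tower_base: "tower {T} T {} {#}"
proof -
  let ?m = "\<lambda>X. if X = T then 1 else 0 :: int"
  have lp: "layer_poset {T} T (\<lambda>_. 0) {}" by standard auto
  have "rk_poset {T} rev_incl = 0"
    by (rule layer_poset.rk_poset_eq[OF lp]) simp
  then have "TM_chain {T} T 0"
    unfolding TM_chain_def by (intro exI[of _ "\<lambda>_. {T}"]) simp
  moreover have "{z. z = T \<and> T \<subseteq> z} = {T}" by auto
  then have "is_mobius {T} T ?m" by (simp add: is_mobius_def)
  ultimately show ?thesis
    unfolding tower_def using lp by (intro exI[of _ "\<lambda>_. 0"] exI[of _ ?m]) simp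
qed

text \<open>Nonemptiness of \<open>A\<close> makes every maximal layer gain one rank, the chain of
  TM-ideals grow strictly, and the new exponent \<open>card A\<close> positive.\<close>

lemma tower_step:
  assumes R: "tower R T At ds" and S: "sections R T At A" and A: "A \<noteq> {}"
  shows "tower (ext R A) T (At \<union> A) (add_mset (card A) ds)"
proof -
  obtain \<rho> m where lp: "layer_poset R T \<rho> At"
    and pure0: "\<forall>y. maximal_in R rev_incl y \<longrightarrow> \<rho> y = size ds"
    and chain: "TM_chain R T (size ds)" and m: "is_mobius R T m"
    and char0: "\<forall>N\<ge>size ds.
      (\<Sum>X\<in>R. monom (m X) (N - \<rho> X)) = monom 1 (N - size ds) * (\<Prod>d\<in>#ds. [:- int d, 1:])"
    and pos: "\<forall>d\<in>#ds. 0 < d"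
    using R unfolding tower_def by (elim exE conjE)
  note pure = pure0[rule_format] and char = char0[rule_format]
  interpret section_extension R T \<rho> At A
    using lp S by (simp add: section_extension_def)
  interpret ext: layer_poset P T rank' "At \<union> A" by (rule ext_layer_poset)
  have pure': "rank' y = Suc (size ds)" if "maximal_in P rev_incl y" for y
    using maximal_ext[OF A that] pure by (simp add: rank'_def)
  have chain': "TM_chain P T (Suc (size ds))"
  proof -
    obtain Qs where Qs: "Qs 0 = {T}" "Qs (size ds) = R"
      "\<forall>i<size ds. Qs i \<subset> Qs (Suc i) \<and> TM_ideal (Qs (Suc i)) rev_incl (Qs i)"
      "\<forall>i\<le>size ds. rk_poset (Qs i) rev_incl = i"
      using chain unfolding TM_chain_def by (elim exE conjE)
    have RP: "R \<subset> P" using R_sub_P A_sub_P A_notin_R A by blast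
    have "TM_ideal P rev_incl R" by (rule TM_ideal_R[OF A pure])
    then show ?thesis
      unfolding TM_chain_def
      using Qs RP ext.rk_poset_eq[OF pure']
      by (intro exI[of _ "Qs(Suc (size ds) := P)"]) (auto simp: less_Suc_eq le_Suc_eq)
  qed
  have char': "(\<Sum>X\<in>P. monom (ext_mobius m X) (N - rank' X))
      = monom 1 (N - Suc (size ds)) * (\<Prod>d\<in>#add_mset (card A) ds. [:- int d, 1:])"
    if N: "Suc (size ds) \<le> N" for N
  proof -
    define p where "p = (\<Prod>d\<in>#ds. [:- int d, 1:])"
    define n where "n = N - Suc (size ds)"
    have e: "N - size ds = Suc n" "N - 1 - size ds = n" "size ds \<le> N" "size ds \<le> N - 1"
      using N by (auto simp: n_def)
    have X: "monom 1 (Suc n) = monom 1 n * (monom 1 1 :: int poly)" by (simp add: mult_monom)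
    have c: "[:- int (card A), 1:] = monom 1 1 - of_nat (card A)"
      by (simp add: monom_altdef of_nat_poly)
    have "(\<Sum>X\<in>P. monom (ext_mobius m X) (N - rank' X))
        = monom 1 (Suc n) * p - of_nat (card A) * (monom 1 n * p)"
      unfolding char_sum_ext char[OF e(3)] char[OF e(4)] e(1,2) p_def ..
    also have "\<dots> = monom 1 n * ((monom 1 1 - of_nat (card A)) * p)"
      unfolding X by (simp add: algebra_simps)
    finally show ?thesis
      unfolding n_def[symmetric] by (simp add: p_def c)
  qed
  have "0 < card A" using A fin_A by (simp add: card_gt_0_iff)
  then show ?thesis
    unfolding tower_def size_add_mset
    using ext.layer_poset_axioms pure' chain' is_mobius_ext[OF m] char' pos
    by (intro exI[of _ rank'] exI[of _ "ext_mobius m"]) simp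
qed

lemma tower_strictly_supersolvable:
  assumes "tower P T At ds"
  shows "strictly_supersolvable P rev_incl" "rk_poset P rev_incl = size ds"
proof -
  obtain \<rho> where lp: "layer_poset P T \<rho> At"
    and pure: "\<forall>y. maximal_in P rev_incl y \<longrightarrow> \<rho> y = size ds"
    and chain: "TM_chain P T (size ds)"
    using assms unfolding tower_def by (elim exE conjE)
  interpret layer_poset P T \<rho> At by (rule lp)
  show rk: "rk_poset P rev_incl = size ds" by (rule rk_poset_eq) (use pure in simp)
  have "is_minimum P rev_incl T" using T_in sub_T by (simp add: is_minimum_def rev_incl_def)
  then show "strictly_supersolvable P rev_incl"
    unfolding strictly_supersolvable_def rk
    using fin partial_order_rev_incl ranked geometric_below chain[unfolded TM_chain_def] by blast
qed

lemma tower_char_poly: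
  assumes "tower (layers l I) (torus l) At ds" "size ds \<le> l"
  shows "char_poly l I = monom 1 (l - size ds) * (\<Prod>d\<in>#ds. [:- int d, 1:])"
proof -
  obtain \<rho> m where lp: "layer_poset (layers l I) (torus l) \<rho> At" and m: "is_mobius (layers l I) (torus l) m"
    and char: "\<forall>N\<ge>size ds. (\<Sum>X\<in>layers l I. monom (m X) (N - \<rho> X))
      = monom 1 (N - size ds) * (\<Prod>d\<in>#ds. [:- int d, 1:])"
    using assms(1) unfolding tower_def by (elim exE conjE)
  interpret layer_poset "layers l I" "torus l" \<rho> At by (rule lp)
  have "mobius (layers l I) rev_incl (torus l) = m"
    using mobius_eq[OF fin T_in sub_T m] by simp
  then have "char_poly l I = (\<Sum>X\<in>layers l I. monom (m X) (l - \<rho> X))"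
    by (simp add: char_poly_def layer_dim_def rk_in_eq)
  then show ?thesis using char assms(2) by simp
qed

section \<open>Graphs in the torus\<close>

definition saturated :: "nat \<Rightarrow> (nat \<Rightarrow> complex) set \<Rightarrow> bool" where
  "saturated i S \<longleftrightarrow> (\<forall>t\<in>S. \<forall>z. cmod z = 1 \<longrightarrow> t(i := z) \<in> S)"

text \<open>The third conjunct makes \<open>f\<close> independent of coordinate \<open>i\<close>, so
  \<open>a\<close> is a graph over the remaining coordinates although \<open>f\<close> lives on the
  whole torus.\<close>

definition graph_over :: "nat \<Rightarrow> nat \<Rightarrow> (nat \<Rightarrow> complex) set \<Rightarrow> bool" where
  "graph_over l i a \<longleftrightarrow> (\<exists>f. continuous_on (torus l) f \<and> (\<forall>t\<in>torus l. cmod (f t) = 1) \<and>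
     (\<forall>t\<in>torus l. \<forall>z. cmod z = 1 \<longrightarrow> f (t(i := z)) = f t) \<and> a = {t \<in> torus l. t i = f t})"

definition layers_of :: "'a::topological_space set \<Rightarrow> 'a set set \<Rightarrow> 'a set set" where
  "layers_of T \<B> = {X. \<exists>B \<subseteq> \<B>. X \<in> components (T \<inter> \<Inter>B)}"

lemma layers_eq_layers_of: "layers l I = layers_of (torus l) (toric_arr l I)"
  by (simp add: layers_def layers_of_def)

lemma one_in_torus: "(\<lambda>_. 1) \<in> torus l"
  by (simp add: torus_def)

lemma torus_upd: "\<lbrakk>t \<in> torus l; i \<in> {1..l}; cmod z = 1\<rbrakk> \<Longrightarrow> t(i := z) \<in> torus l"
  by (auto simp: torus_def)

lemma connected_torus: "connected (torus l)"
proof -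
  have "connected_component (torus l) (\<lambda>_. 1) t" if t: "t \<in> torus l" for t
  proof -
    have cm: "cmod (t k) = 1" for k using t by (cases "k \<in> {1..l}") (auto simp: torus_def)
    \<comment> \<open>A path from the identity to \<open>t\<close> that scales all arguments.
      Coordinates outside \<open>{1..l}\<close> are 1, have argument 0 and stay fixed, so the path
      remains in the torus.\<close>
    define g where "g = (\<lambda>(s::real) k. cis (s * Arg (t k)))"
    have "continuous_on {0..1} g"
      unfolding g_def
      by (intro continuous_on_coordinatewise_then_product continuous_intros)
    then have "connected (g ` {0..1})" by (intro connected_continuous_image) auto
    moreover have "g ` {0..1} \<subseteq> torus l"
      using t by (auto simp: g_def torus_def)
    moreover have "g 0 = (\<lambda>_. 1)" by (simp add: g_def)
    then have "(\<lambda>_. 1) \<in> g ` {0..1}" by (intro rev_image_eqI[of 0]) auto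
    moreover have "g 1 = t"
    proof
      fix k
      have "t k \<noteq> 0" using cm[of k] by auto
      then show "g 1 k = t k" using cm[of k] by (simp add: g_def cis_Arg sgn_eq)
    qed
    then have "t \<in> g ` {0..1}" by (intro rev_image_eqI[of 1]) auto
    ultimately show ?thesis
      unfolding connected_component_def
      by (intro exI[of _ "g ` {0..1}"] conjI)
  qed
  then show ?thesis
    by (metis connected_component_sym connected_component_trans connected_iff_connected_component)
qed

lemma layers_of_empty: "layers_of (torus l) {} = {torus l}"
  using connected_torus one_in_torus[of l] by (auto simp: layers_of_def components_eq_sing_iff)

lemma graph_section:
  assumes a: "graph_over l i a" and Y: "Y \<subseteq> torus l" "saturated i Y" and t: "t \<in> Y"
  shows "\<exists>z. cmod z = 1 \<and> t(i := z) \<in> Y \<inter> a"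
proof -
  obtain f where f: "\<forall>t\<in>torus l. cmod (f t) = 1"
    "\<forall>t\<in>torus l. \<forall>z. cmod z = 1 \<longrightarrow> f (t(i := z)) = f t" "a = {t \<in> torus l. t i = f t}"
    using a by (auto simp: graph_over_def)
  have tT: "t \<in> torus l" using t Y by auto
  have 1: "t(i := f t) \<in> Y" using Y t f(1) tT by (simp add: saturated_def)
  then have "t(i := f t) \<in> torus l" using Y by auto
  then have "t(i := f t) \<in> a" using f tT by simp
  then show ?thesis using 1 f(1) tT by blast
qed

text \<open>Resetting coordinate \<open>i\<close> to \<open>f t\<close> is a continuous map from
  \<open>Y\<close> onto \<open>Y \<inter> a\<close>; saturation keeps its values in
  \<open>Y\<close>.\<close>

lemma connected_graph:
  assumes a: "graph_over l i a" and Y: "Y \<subseteq> torus l" "saturated i Y" "connected Y"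
  shows "connected (Y \<inter> a)"
proof -
  obtain f where cont: "continuous_on (torus l) f" and f: "\<forall>t\<in>torus l. cmod (f t) = 1"
    "\<forall>t\<in>torus l. \<forall>z. cmod z = 1 \<longrightarrow> f (t(i := z)) = f t" "a = {t \<in> torus l. t i = f t}"
    using a by (auto simp: graph_over_def)
  have "Y \<inter> a = (\<lambda>t. t(i := f t)) ` Y"
  proof (intro subset_antisym subsetI)
    fix t assume "t \<in> Y \<inter> a"
    then have "t \<in> Y" "t = t(i := f t)" using f(3) by auto
    then show "t \<in> (\<lambda>t. t(i := f t)) ` Y" by blast
  next
    fix s assume "s \<in> (\<lambda>t. t(i := f t)) ` Y"
    then obtain t where t: "t \<in> Y" "s = t(i := f t)" by auto
    have tT: "t \<in> torus l" using t Y by auto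
    have "s \<in> Y" using t Y(2) f(1) tT by (simp add: saturated_def)
    moreover have "s \<in> torus l" using \<open>s \<in> Y\<close> Y by auto
    ultimately show "s \<in> Y \<inter> a" using f t tT by simp
  qed
  moreover have "continuous_on Y (\<lambda>t. t(i := f t))"
  proof (rule continuous_on_coordinatewise_then_product)
    fix k
    show "continuous_on Y (\<lambda>t. (t(i := f t)) k)"
      using continuous_on_subset[OF cont Y(1)]
      by (cases "k = i") (auto intro: continuous_on_subset[OF continuous_on_product_coordinates])
  qed
  ultimately show ?thesis using Y(3) by (simp add: connected_continuous_image)
qed

text \<open>The circle swept out by coordinate \<open>i\<close> through a point of \<open>Y\<close>
  is connected and contained in \<open>S\<close>, hence contained in the component.\<close>

lemma sat_component:
  assumes "saturated i S" "Y \<in> components S"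
    and unit: "\<And>t. t \<in> S \<Longrightarrow> cmod (t i) = 1"
  shows "saturated i Y"
  unfolding saturated_def
proof (intro ballI allI impI)
  fix t z assume t: "t \<in> Y" and z: "cmod z = (1::real)"
  have tS: "t \<in> S" using t assms(2) in_components_subset by blast
  let ?C = "(\<lambda>w. t(i := w)) ` sphere 0 1"
  have "continuous_on (sphere 0 1) (\<lambda>w. t(i := w))"
  proof (rule continuous_on_coordinatewise_then_product)
    fix k
    show "continuous_on (sphere 0 1) (\<lambda>w. (t(i := w)) k)"
      by (cases "k = i") (auto intro: continuous_intros)
  qed
  moreover have "connected (sphere (0::complex) 1)" by (rule connected_sphere) simp
  ultimately have "connected ?C" by (rule connected_continuous_image)
  moreover have "?C \<subseteq> S" using assms(1) tS by (auto simp: saturated_def)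
  moreover have "t(i := t i) \<in> ?C" using unit[OF tS] by (intro imageI) simp
  then have "Y \<inter> ?C \<noteq> {}" using t by auto
  ultimately have "?C \<subseteq> Y" using components_maximal[OF assms(2)] by blast
  then show "t(i := z) \<in> Y" using z by auto
qed

text \<open>The intersection of two graphs may have components lying in different members of
  \<open>\<B>\<close>. So \<open>d\<close> may depend on the point \<open>t\<close>, and only
  connected sets \<open>X\<close> through \<open>t\<close> are tested, which confines the claim to
  the component of \<open>t\<close>.\<close>

locale graph_arrangement =
  fixes l i :: nat and \<B> A :: "(nat \<Rightarrow> complex) set set"
  assumes i: "i \<in> {1..l}"
    and sat_B: "\<And>b. b \<in> \<B> \<Longrightarrow> saturated i b"
    and finA: "finite A"
    and graph: "\<And>a. a \<in> A \<Longrightarrow> graph_over l i a"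
    and coincide: "\<And>a b t. \<lbrakk>a \<in> A; b \<in> A; a \<noteq> b; t \<in> a; t \<in> b\<rbrakk> \<Longrightarrow>
      \<exists>d\<in>\<B>. \<forall>X. connected X \<longrightarrow> t \<in> X \<longrightarrow> X \<subseteq> a \<longrightarrow> (X \<subseteq> b \<longleftrightarrow> X \<subseteq> d)"
begin

abbreviation "T \<equiv> torus l"
abbreviation "R \<equiv> layers_of T \<B>"

lemma a_sub_T: "a \<in> A \<Longrightarrow> a \<subseteq> T"
  using graph by (auto simp: graph_over_def)

lemma unit: "t \<in> T \<Longrightarrow> cmod (t i) = 1"
  using i by (simp add: torus_def)

lemma sat_inter:
  assumes "B \<subseteq> \<B>"
  shows "saturated i (T \<inter> \<Inter>B)"
  unfolding saturated_def
proof (intro ballI allI impI)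
  fix t z assume "t \<in> T \<inter> \<Inter>B" "cmod z = (1::real)"
  then show "t(i := z) \<in> T \<inter> \<Inter>B"
    using sat_B assms torus_upd[OF _ i] by (auto simp: saturated_def subset_iff)
qed

lemma R_props:
  assumes "Y \<in> R"
  shows "Y \<subseteq> T" "Y \<noteq> {}" "connected Y" "saturated i Y"
proof -
  obtain B where B: "B \<subseteq> \<B>" "Y \<in> components (T \<inter> \<Inter>B)" using assms by (auto simp: layers_of_def)
  show "Y \<subseteq> T" using in_components_subset[OF B(2)] by simp
  show "Y \<noteq> {}" "connected Y"
    using in_components_nonempty[OF B(2)] in_components_connected[OF B(2)] by auto
  show "saturated i Y" by (rule sat_component[OF sat_inter[OF B(1)] B(2)]) (simp add: unit)
qed

lemma ext_props:
  assumes "X \<in> ext R A"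
  shows "X \<noteq> {}" "connected X"
proof -
  consider "X \<in> R" | Y a where "Y \<in> R" "a \<in> A" "X = Y \<inter> a" using assms by (auto simp: ext_def)
  then have "X \<noteq> {} \<and> connected X"
  proof cases
    case 1
    then show ?thesis using R_props by simp
  next
    case 2
    then obtain t where "t \<in> Y" using R_props(2)[of Y] by blast
    then have "X \<noteq> {}" using graph_section[OF graph[OF 2(2)] R_props(1,4)[OF 2(1)]] 2(3) by blast
    then show ?thesis using connected_graph[OF graph[OF 2(2)] R_props(1,4,3)[OF 2(1)]] 2(3) by simp
  qed
  then show "X \<noteq> {}" "connected X" by auto
qed

text \<open>\<open>Y \<inter> a\<close> is connected as a graph over \<open>Y\<close>, and any
  connected set containing it inside the same intersection stays in the component
  \<open>Y\<close>.\<close>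

lemma section_in_layers_of:
  assumes Y: "Y \<in> R" and a: "a \<in> A"
  shows "Y \<inter> a \<in> layers_of T (\<B> \<union> A)"
proof -
  obtain B where B: "B \<subseteq> \<B>" "Y \<in> components (T \<inter> \<Inter>B)" using Y by (auto simp: layers_of_def)
  have X: "Y \<inter> a \<noteq> {}" "connected (Y \<inter> a)" using ext_props[of "Y \<inter> a"] Y a by (auto simp: ext_def)
  have "Y \<inter> a \<in> components (T \<inter> \<Inter>(insert a B))"
    unfolding in_components_maximal
  proof (intro conjI allI impI X)
    show "Y \<inter> a \<subseteq> T \<inter> \<Inter>(insert a B)" using in_components_subset[OF B(2)] by auto
    fix C assume C: "C \<noteq> {} \<and> Y \<inter> a \<subseteq> C \<and> C \<subseteq> T \<inter> \<Inter>(insert a B) \<and> connected C"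
    then have "C \<subseteq> Y" using components_maximal[OF B(2), of C] X(1) by auto
    then show "C = Y \<inter> a" using C by auto
  qed
  moreover have "insert a B \<subseteq> \<B> \<union> A" using B a by auto
  ultimately show ?thesis unfolding layers_of_def by blast
qed

text \<open>Keep one graph \<open>a\<close> from \<open>B\<close> and replace every other graph
  \<open>b\<close> by the member \<open>d b\<close> of \<open>\<B>\<close> that cuts it out on
  \<open>a\<close> near a point \<open>t\<close> of \<open>X\<close>. The component \<open>Y\<close>
  through \<open>t\<close> of the new intersection is a layer of \<open>\<B>\<close>, and
  \<open>X = Y \<inter> a\<close>.\<close>

lemma layers_of_cases:
  assumes "X \<in> layers_of T (\<B> \<union> A)"
  shows "X \<in> ext R A"
proof -
  obtain B where B: "B \<subseteq> \<B> \<union> A" "X \<in> components (T \<inter> \<Inter>B)" using assms by (auto simp: layers_of_def)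
  show ?thesis
  proof (cases "B \<subseteq> \<B>")
    case True
    then show ?thesis using B by (auto simp: ext_def layers_of_def)
  next
    case False
    then obtain a where a: "a \<in> A" "a \<in> B" using B by auto
    have Xs: "X \<subseteq> T \<inter> \<Inter>B" and Xc: "connected X"
      using in_components_subset in_components_connected B(2) by auto
    have XB: "X \<subseteq> b" if "b \<in> B" for b using that Xs by auto
    obtain t where t: "t \<in> X" using in_components_nonempty[OF B(2)] by blast
    have "\<forall>b\<in>B \<inter> A - {a}. \<exists>d\<in>\<B>. \<forall>X. connected X \<longrightarrow> t \<in> X \<longrightarrow> X \<subseteq> a \<longrightarrow> (X \<subseteq> b \<longleftrightarrow> X \<subseteq> d)"
      using coincide a XB t by blast
    then obtain d where d: "\<And>b. b \<in> B \<inter> A - {a} \<Longrightarrow> d b \<in> \<B>"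
      "\<And>b X. \<lbrakk>b \<in> B \<inter> A - {a}; connected X; t \<in> X; X \<subseteq> a\<rbrakk> \<Longrightarrow> X \<subseteq> b \<longleftrightarrow> X \<subseteq> d b"
      by metis
    define B' where "B' = (B \<inter> \<B>) \<union> d ` (B \<inter> A - {a})"
    have B': "B' \<subseteq> \<B>" using d(1) by (auto simp: B'_def)
    have "X \<subseteq> d b" if "b \<in> B \<inter> A - {a}" for b using d(2)[OF that Xc t] XB a that by auto
    then have XS: "X \<subseteq> T \<inter> \<Inter>B'" using XB Xs by (auto simp: B'_def)
    define Y where "Y = connected_component_set (T \<inter> \<Inter>B') t"
    have tS: "t \<in> T \<inter> \<Inter>B'" using t XS by auto
    then have Yc: "Y \<in> components (T \<inter> \<Inter>B')" by (auto simp: Y_def components_def)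
    then have YR: "Y \<in> R" using B' by (auto simp: layers_of_def)
    have "X \<subseteq> Y" unfolding Y_def by (rule connected_component_maximal[OF t Xc XS])
    then have XYa: "X \<subseteq> Y \<inter> a" using XB[OF a(2)] by auto
    have Yac: "connected (Y \<inter> a)" using ext_props[of "Y \<inter> a"] YR a by (auto simp: ext_def)
    \<comment> \<open>\<open>Y \<inter> a\<close> is connected, passes through \<open>t\<close> and
      lies in \<open>a\<close>, so \<open>d b\<close> may be exchanged back for \<open>b\<close>.
      Maximality of the component \<open>X\<close> then gives equality.\<close>
    have "Y \<inter> a \<subseteq> b" if b: "b \<in> B" for b
    proof (cases "b \<in> A \<and> b \<noteq> a")
      case True
      then have b': "b \<in> B \<inter> A - {a}" using b by auto
      have "Y \<subseteq> d b" using in_components_subset[OF Yc] b' by (auto simp: B'_def)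
      then show ?thesis using d(2)[OF b' Yac] t XYa by auto
    next
      case False
      then have "b = a \<or> b \<in> B \<inter> \<B>" using b B by auto
      then show ?thesis using in_components_subset[OF Yc] by (auto simp: B'_def)
    qed
    then have "Y \<inter> a \<subseteq> T \<inter> \<Inter>B" using a_sub_T[OF a(1)] by auto
    moreover have "X \<inter> (Y \<inter> a) \<noteq> {}" using t XYa by auto
    ultimately have "Y \<inter> a \<subseteq> X" by (rule components_maximal[OF B(2) Yac])
    then have "X = Y \<inter> a" using XYa by simp
    then show ?thesis using YR a by (auto simp: ext_def)
  qed
qed

lemma layers_of_Un_eq: "layers_of T (\<B> \<union> A) = ext R A"
proof (intro subset_antisym subsetI)
  fix X assume "X \<in> ext R A"
  then consider "X \<in> R" | Y a where "Y \<in> R" "a \<in> A" "X = Y \<inter> a" by (auto simp: ext_def)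
  then show "X \<in> layers_of T (\<B> \<union> A)"
  proof cases
    case 1
    then show ?thesis unfolding layers_of_def by blast
  next
    case 2
    then show ?thesis using section_in_layers_of by simp
  qed
qed (rule layers_of_cases)

lemma sections: "sections R T \<B> A"
proof
  show "finite A" by (rule finA)
  show "a \<subseteq> T" if "a \<in> A" for a by (rule a_sub_T[OF that])
next
  fix Y Z a assume Y: "Y \<in> R" and Z: "Z \<in> R" and a: "a \<in> A" and sub: "Y \<inter> a \<subseteq> Z"
  show "Y \<subseteq> Z"
  proof
    fix t assume t: "t \<in> Y"
    then obtain z where "t(i := z) \<in> Z"
      using graph_section[OF graph[OF a] R_props(1,4)[OF Y] t] sub by blast
    moreover have "cmod (t i) = 1" using unit t R_props(1)[OF Y] by auto
    ultimately have "(t(i := z))(i := t i) \<in> Z" using R_props(4)[OF Z] unfolding saturated_def by blast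
    then show "t \<in> Z" by simp
  qed
next
  fix Y a assume Y: "Y \<in> R" and a: "a \<in> A"
  show "\<not> Y \<subseteq> a"
  proof
    assume Ya: "Y \<subseteq> a"
    obtain t where t: "t \<in> Y" using R_props(2)[OF Y] by blast
    obtain f where f: "\<forall>t\<in>T. \<forall>z. cmod z = 1 \<longrightarrow> f (t(i := z)) = f t" "a = {t \<in> T. t i = f t}"
      using graph[OF a] by (auto simp: graph_over_def)
    have tT: "t \<in> T" using t R_props(1)[OF Y] by auto
    \<comment> \<open>Saturation allows replacing \<open>t i\<close> by its antipode without leaving
      \<open>Y\<close>, whereas a graph takes one value there; this would force
      \<open>t i = - t i\<close>.\<close>
    have u: "cmod (- t i) = 1" using unit[OF tT] by simp
    have "t(i := - t i) \<in> a" using R_props(4)[OF Y] t u Ya unfolding saturated_def by blast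
    then have "- t i = f t" using f tT u by auto
    moreover have "t i = f t" using Ya t f(2) by auto
    ultimately have "t i = - t i" by simp
    then have "t i = 0" by simp
    then show False using unit[OF tT] by simp
  qed
next
  fix a b u assume a: "a \<in> A" and b: "b \<in> A" and ab: "a \<noteq> b" and u: "u \<in> ext R A" "u \<subseteq> a" "u \<subseteq> b"
  obtain t where t: "t \<in> u" using ext_props(1)[OF u(1)] by blast
  then have "t \<in> a" "t \<in> b" using u by auto
  from coincide[OF a b ab this] obtain d where d: "d \<in> \<B>"
    "\<And>X. \<lbrakk>connected X; t \<in> X; X \<subseteq> a\<rbrakk> \<Longrightarrow> X \<subseteq> b \<longleftrightarrow> X \<subseteq> d" by metis
  have "u \<subseteq> d" using d(2)[OF ext_props(2)[OF u(1)] t u(2)] u(3) by simp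
  moreover have "X \<subseteq> b \<longleftrightarrow> X \<subseteq> d" if "X \<in> ext R A" "u \<subseteq> X" "X \<subseteq> a" for X
    using d(2)[OF ext_props(2)[OF that(1)] _ that(3)] t that(2) by auto
  ultimately show "\<exists>d\<in>\<B>. u \<subseteq> d \<and> (\<forall>X\<in>ext R A. u \<subseteq> X \<longrightarrow> X \<subseteq> a \<longrightarrow> (X \<subseteq> b \<longleftrightarrow> X \<subseteq> d))"
    using d(1) by (intro bexI[of _ d]) simp_all
qed

end

section \<open>Roots of type C and their hypersurfaces\<close>

definition pos_cone :: "nat \<Rightarrow> ivec \<Rightarrow> bool" where
  "pos_cone l v \<longleftrightarrow> (\<exists>c :: nat \<Rightarrow> nat. \<forall>k. v k = (\<Sum>i=1..l. int (c i) * simple_root_C l i k))"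

lemma root_le_iff: "root_le l \<gamma> \<beta> \<longleftrightarrow> pos_cone l (vsub \<beta> \<gamma>)"
  by (simp add: root_le_def pos_cone_def vsub_def)

lemma pos_cone_add:
  assumes "pos_cone l u" "pos_cone l v"
  shows "pos_cone l (vadd u v)"
proof -
  obtain c d :: "nat \<Rightarrow> nat" where "\<forall>k. u k = (\<Sum>i=1..l. int (c i) * simple_root_C l i k)"
    "\<forall>k. v k = (\<Sum>i=1..l. int (d i) * simple_root_C l i k)"
    using assms unfolding pos_cone_def by blast
  then show ?thesis
    unfolding pos_cone_def vadd_def
    by (intro exI[of _ "\<lambda>i. c i + d i"]) (simp add: sum.distrib algebra_simps)
qed

lemma pos_cone_simple:
  assumes "1 \<le> i" "i \<le> l"
  shows "pos_cone l (simple_root_C l i)"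
proof -
  have "(\<Sum>m=1..l. int (if m = i then 1 else 0) * simple_root_C l m k) = simple_root_C l i k" for k
  proof -
    have "(\<Sum>m=1..l. int (if m = i then 1 else 0) * simple_root_C l m k)
        = (\<Sum>m=1..l. if m = i then simple_root_C l m k else 0)"
      by (rule sum.cong) auto
    then show ?thesis using assms by simp
  qed
  then show ?thesis
    unfolding pos_cone_def by (intro exI[of _ "\<lambda>m. if m = i then 1 else 0"]) simp
qed

text \<open>Telescoping over simple roots. The case \<open>i = j\<close> gives the zero vector and
  is needed for \<open>2\<epsilon>\<^sub>l\<close> in \<open>pos_cone_double\<close>.\<close>

lemma pos_cone_diff: "\<lbrakk>1 \<le> i; i \<le> j; j \<le> l\<rbrakk> \<Longrightarrow> pos_cone l (vsub (eps i) (eps j))"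
proof (induction j)
  case (Suc j)
  show ?case
  proof (cases "i = Suc j")
    case True
    then show ?thesis unfolding pos_cone_def vsub_def by (intro exI[of _ "\<lambda>_. 0"]) simp
  next
    case False
    then have "pos_cone l (vsub (eps i) (eps j))" "pos_cone l (simple_root_C l j)"
      using Suc by (auto intro: pos_cone_simple)
    moreover have "vsub (eps i) (eps (Suc j)) = vadd (vsub (eps i) (eps j)) (simple_root_C l j)"
      using Suc.prems by (auto simp: vsub_def vadd_def simple_root_C_def)
    ultimately show ?thesis using pos_cone_add by simp
  qed
qed simp

lemma pos_cone_double:
  assumes "1 \<le> i" "i \<le> l"
  shows "pos_cone l (vscale 2 (eps i))"
proof -
  have "vscale 2 (eps i)
      = vadd (vadd (vsub (eps i) (eps l)) (vsub (eps i) (eps l))) (simple_root_C l l)"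
    by (auto simp: vsub_def vadd_def vscale_def simple_root_C_def)
  then show ?thesis
    using assms by (simp add: pos_cone_add pos_cone_diff pos_cone_simple)
qed

lemma pos_cone_sum:
  assumes "1 \<le> i" "i \<le> j" "j \<le> l"
  shows "pos_cone l (vadd (eps i) (eps j))"
proof -
  have "vadd (eps i) (eps j) = vadd (vsub (eps i) (eps j)) (vscale 2 (eps j))"
    by (auto simp: vsub_def vadd_def vscale_def)
  then show ?thesis
    using assms by (simp add: pos_cone_add pos_cone_diff pos_cone_double)
qed

lemma vadd_commute: "vadd u v = vadd v u"
  by (auto simp: vadd_def)

lemma root_mem:
  "\<lbrakk>1 \<le> i; i \<le> l\<rbrakk> \<Longrightarrow> vscale 2 (eps i) \<in> pos_roots_C l"
  "\<lbrakk>1 \<le> i; i < j; j \<le> l\<rbrakk> \<Longrightarrow> vsub (eps i) (eps j) \<in> pos_roots_C l"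
  "\<lbrakk>1 \<le> i; i < j; j \<le> l\<rbrakk> \<Longrightarrow> vadd (eps i) (eps j) \<in> pos_roots_C l"
  by (auto simp: pos_roots_C_def)

lemma ideal_down:
  assumes "root_ideal l I" "\<beta> \<in> I" "\<gamma> \<in> pos_roots_C l" "pos_cone l v" "vsub \<beta> \<gamma> = v"
  shows "\<gamma> \<in> I"
  using assms by (auto simp: root_ideal_def root_le_iff)

section \<open>Roots forced into an ideal by downward closure\<close>

context
  fixes l :: nat and I :: "ivec set"
  assumes ideal: "root_ideal l I"
begin

lemma ideal_diff_diff:
  assumes "vsub (eps i) (eps k) \<in> I" "1 \<le> i" "i < j" "j < k" "k \<le> l"
  shows "vsub (eps j) (eps k) \<in> I"
  by (rule ideal_down[OF ideal assms(1) root_mem(2) pos_cone_diff[of i j]])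
    (use assms in \<open>auto simp: vsub_def\<close>)

lemma ideal_sum_sum:
  assumes "vadd (eps i) (eps k) \<in> I" "1 \<le> i" "i < j" "j \<noteq> k" "j \<le> l" "i < k" "k \<le> l"
  shows "vadd (eps j) (eps k) \<in> I"
proof -
  have "vadd (eps j) (eps k) \<in> pos_roots_C l"
    using root_mem(3)[of j k l] root_mem(3)[of k j l] assms vadd_commute[of "eps j" "eps k"]
    by (cases "j < k") auto
  then show ?thesis
    by (rule ideal_down[OF ideal assms(1) _ pos_cone_diff[of i j]])
      (use assms in \<open>auto simp: vsub_def vadd_def\<close>)
qed

lemma ideal_sum_double:
  assumes "vadd (eps i) (eps j) \<in> I" "1 \<le> i" "i < j" "j \<le> l"
  shows "vscale 2 (eps j) \<in> I"
  by (rule ideal_down[OF ideal assms(1) root_mem(1) pos_cone_diff[of i j]])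
    (use assms in \<open>auto simp: vsub_def vadd_def vscale_def\<close>)

text \<open>The difference of the two roots is
  \<open>\<epsilon>\<^sub>i + \<epsilon>\<^sub>k\<close>. This root cuts out
  \<open>t\<^sub>j = t\<^sub>k\<close>, the agreement locus of the graphs
  \<open>t\<^sub>i = 1/t\<^sub>j\<close> and \<open>t\<^sub>i = 1/t\<^sub>k\<close>.\<close>

lemma ideal_sum_diff:
  assumes "vadd (eps i) (eps j) \<in> I" "1 \<le> i" "i < j" "j < k" "k \<le> l"
  shows "vsub (eps j) (eps k) \<in> I"
  by (rule ideal_down[OF ideal assms(1) root_mem(2) pos_cone_sum[of i k]])
    (use assms in \<open>auto simp: vsub_def vadd_def\<close>)

lemma ideal_double_double:
  assumes "vscale 2 (eps i) \<in> I" "1 \<le> i" "i \<le> j" "j \<le> l"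
  shows "vscale 2 (eps j) \<in> I"
  by (rule ideal_down[OF ideal assms(1) root_mem(1)
        pos_cone_add[OF pos_cone_diff[of i j] pos_cone_diff[of i j]]])
    (use assms in \<open>auto simp: vsub_def vadd_def vscale_def\<close>)

lemma ideal_double_row:
  assumes "vscale 2 (eps i) \<in> I" "1 \<le> i" "i < j" "j \<le> l"
  shows "vsub (eps i) (eps j) \<in> I" "vadd (eps i) (eps j) \<in> I"
proof -
  show "vsub (eps i) (eps j) \<in> I"
    by (rule ideal_down[OF ideal assms(1) root_mem(2) pos_cone_sum[of i j]])
      (use assms in \<open>auto simp: vsub_def vadd_def vscale_def\<close>)
  show "vadd (eps i) (eps j) \<in> I"
    by (rule ideal_down[OF ideal assms(1) root_mem(3) pos_cone_diff[of i j]])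
      (use assms in \<open>auto simp: vsub_def vadd_def vscale_def\<close>)
qed

end

section \<open>Hypersurfaces grouped by leading coordinate\<close>

definition row_idx :: "nat \<Rightarrow> ivec set \<Rightarrow> nat \<Rightarrow> (nat \<times> bool) set" where
  "row_idx l I i = {(j, \<sigma>). i < j \<and> j \<le> l \<and> (if \<sigma> then vadd else vsub) (eps i) (eps j) \<in> I}"

text \<open>The flag is the sign of the root: \<open>\<epsilon>\<^sub>i + \<epsilon>\<^sub>j\<close>
  reads \<open>t\<^sub>i t\<^sub>j = 1\<close>, which as a graph over the later coordinates takes
  the inverse.\<close>

definition pair_torus :: "nat \<Rightarrow> nat \<Rightarrow> nat \<times> bool \<Rightarrow> (nat \<Rightarrow> complex) set" where
  "pair_torus l i p = {t \<in> torus l. t i = (if snd p then inverse (t (fst p)) else t (fst p))}"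

definition pt_torus :: "nat \<Rightarrow> nat \<Rightarrow> complex \<Rightarrow> (nat \<Rightarrow> complex) set" where
  "pt_torus l i z = {t \<in> torus l. t i = z}"

definition row_arr :: "nat \<Rightarrow> ivec set \<Rightarrow> nat \<Rightarrow> (nat \<Rightarrow> complex) set set" where
  "row_arr l I i = pair_torus l i ` row_idx l I i \<union>
     (if vscale 2 (eps i) \<in> I then {pt_torus l i 1, pt_torus l i (-1)} else {})"

lemma torus_unit: "t \<in> torus l \<Longrightarrow> cmod (t k) = 1"
  by (cases "k \<in> {1..l}") (auto simp: torus_def)

lemma torus_nz: "t \<in> torus l \<Longrightarrow> t k \<noteq> 0"
  using torus_unit[of t l k] by auto

lemma graph_pair:
  assumes "i < fst p"
  shows "graph_over l i (pair_torus l i p)"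
proof -
  obtain j \<sigma> where p: "p = (j, \<sigma>)" by (cases p)
  have "continuous_on (torus l) (\<lambda>t. t j)"
    by (rule continuous_on_subset[OF continuous_on_product_coordinates]) simp
  then have "continuous_on (torus l) (\<lambda>t. if \<sigma> then inverse (t j) else t j)"
    using torus_nz by (cases \<sigma>) (auto intro: continuous_on_inverse)
  then show ?thesis
    unfolding graph_over_def
    by (intro exI[of _ "\<lambda>t. if \<sigma> then inverse (t j) else t j"])
      (use assms torus_unit in \<open>auto simp: p pair_torus_def norm_inverse\<close>)
qed

lemma graph_pt: "cmod z = 1 \<Longrightarrow> graph_over l i (pt_torus l i z)"
  unfolding graph_over_def pt_torus_def by (intro exI[of _ "\<lambda>_. z"]) auto

lemma graph_connected:
  assumes "graph_over l i a" "i \<in> {1..l}"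
  shows "connected a"
proof -
  have "saturated i (torus l)" using torus_upd assms(2) by (auto simp: saturated_def)
  then have "connected (torus l \<inter> a)"
    using connected_graph[OF assms(1) order_refl] connected_torus by blast
  moreover have "torus l \<inter> a = a" using assms(1) by (auto simp: graph_over_def)
  ultimately show ?thesis by simp
qed

text \<open>A continuous image of \<open>X\<close> in the two-point set \<open>{1, -1}\<close> is
  finite and connected, hence a single point.\<close>

lemma connected_sign_constant:
  fixes X :: "(nat \<Rightarrow> complex) set"
  assumes "connected X" "t \<in> X" "\<And>s. s \<in> X \<Longrightarrow> s i = 1 \<or> s i = -1" "s \<in> X"
  shows "s i = t i"
proof -
  have "continuous_on X (\<lambda>t. t i)"
    by (rule continuous_on_subset[OF continuous_on_product_coordinates]) simp
  then have "connected ((\<lambda>t. t i) ` X)" using assms(1) by (rule connected_continuous_image)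
  moreover have "finite ((\<lambda>t. t i) ` X)"
    by (rule finite_subset[of _ "{1, -1}"]) (use assms(3) in auto)
  ultimately obtain z where "(\<lambda>t. t i) ` X = {z}"
    using assms(2) connected_finite_iff_sing by blast
  then show ?thesis using assms(2,4) by (metis imageI singletonD)
qed

text \<open>On a connected subset the coordinate \<open>i\<close> is constant, so the subset lies in
  one of the two pieces; each piece is connected, being a graph.\<close>

lemma components_pt:
  assumes i: "i \<in> {1..l}"
  shows "components (pt_torus l i 1 \<union> pt_torus l i (-1)) = {pt_torus l i 1, pt_torus l i (-1)}"
    (is "components ?U = _")
proof -
  have pt: "connected (pt_torus l i z)" "pt_torus l i z \<noteq> {}" if "z = 1 \<or> z = -1" for z
  proof -
    have u: "cmod z = 1" using that by auto
    show "connected (pt_torus l i z)" by (rule graph_connected[OF graph_pt[OF u] i])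
    have "(\<lambda>_. 1)(i := z) \<in> pt_torus l i z"
      using torus_upd[OF one_in_torus i u] by (simp add: pt_torus_def)
    then show "pt_torus l i z \<noteq> {}" by blast
  qed
  have const: "\<exists>z. (z = 1 \<or> z = -1) \<and> C \<subseteq> pt_torus l i z \<and> (\<forall>w. C \<inter> pt_torus l i w \<noteq> {} \<longrightarrow> w = z)"
    if C: "connected C" "C \<subseteq> ?U" "C \<noteq> {}" for C
  proof -
    obtain t where t: "t \<in> C" using C by blast
    have sgn: "s i = 1 \<or> s i = -1" if "s \<in> C" for s using that C(2) by (auto simp: pt_torus_def)
    have "s i = t i" if "s \<in> C" for s using connected_sign_constant[OF C(1) t sgn that] .
    then have "C \<subseteq> pt_torus l i (t i)" "\<forall>w. C \<inter> pt_torus l i w \<noteq> {} \<longrightarrow> w = t i"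
      using C(2) by (auto simp: pt_torus_def)
    then show ?thesis using sgn[OF t] by blast
  qed
  have comp: "pt_torus l i z \<in> components ?U" if z: "z = 1 \<or> z = -1" for z
    unfolding in_components_maximal
  proof (intro conjI allI impI)
    show "pt_torus l i z \<noteq> {}" "connected (pt_torus l i z)" using pt z by auto
    show "pt_torus l i z \<subseteq> ?U" using z by auto
    fix C assume C: "C \<noteq> {} \<and> pt_torus l i z \<subseteq> C \<and> C \<subseteq> ?U \<and> connected C"
    then obtain w where w: "C \<subseteq> pt_torus l i w" "\<forall>w'. C \<inter> pt_torus l i w' \<noteq> {} \<longrightarrow> w' = w"
      using const[of C] by blast
    have "C \<inter> pt_torus l i z \<noteq> {}" using C pt(2)[OF z] by blast
    then have "z = w" using w(2) by blast
    then show "C = pt_torus l i z" using C w(1) by blast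
  qed
  show ?thesis
  proof (intro subset_antisym subsetI)
    fix X assume X: "X \<in> components ?U"
    then obtain z where z: "z = 1 \<or> z = -1" "X \<subseteq> pt_torus l i z"
      using const[of X] in_components_connected in_components_subset in_components_nonempty by metis
    have "X \<inter> pt_torus l i z \<noteq> {}" using z in_components_nonempty[OF X] by blast
    then have "X = pt_torus l i z" using components_nonoverlap[OF X comp[OF z(1)]] by blast
    then show "X \<in> {pt_torus l i 1, pt_torus l i (-1)}" using z by auto
  qed (use comp in auto)
qed

lemma prod_support:
  fixes l :: nat
  assumes "S \<subseteq> {1..l}" "\<And>k. k \<notin> S \<Longrightarrow> \<beta> k = 0"
  shows "(\<Prod>k=1..l. t k powi \<beta> k) = (\<Prod>k\<in>S. (t k :: complex) powi \<beta> k)"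
  using assms by (intro prod.mono_neutral_right) auto

lemma hypertorus_pair:
  assumes "1 \<le> i" "i < j" "j \<le> l"
  shows "hypertorus l ((if \<sigma> then vadd else vsub) (eps i) (eps j)) = pair_torus l i (j, \<sigma>)"
proof -
  have "(\<Prod>k=1..l. t k powi ((if \<sigma> then vadd else vsub) (eps i) (eps j)) k)
      = (\<Prod>k\<in>{i, j}. t k powi ((if \<sigma> then vadd else vsub) (eps i) (eps j)) k)" for t :: "nat \<Rightarrow> complex"
    by (rule prod_support) (use assms in \<open>auto simp: vadd_def vsub_def eps_def\<close>)
  then have prod: "(\<Prod>k=1..l. t k powi ((if \<sigma> then vadd else vsub) (eps i) (eps j)) k)
      = t i * (if \<sigma> then t j else inverse (t j))" for t :: "nat \<Rightarrow> complex"
    using assms by (simp add: vadd_def vsub_def eps_def power_int_minus)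
  have "t i * (if \<sigma> then t j else inverse (t j)) = 1 \<longleftrightarrow>
      t i = (if \<sigma> then inverse (t j) else t j)" if "t \<in> torus l" for t
    using torus_nz[OF that, of j] by (auto simp: field_simps)
  then show ?thesis
    unfolding hypertorus_def pair_torus_def prod fst_conv snd_conv by (intro Collect_cong conj_cong refl)
qed

lemma hypertorus_double:
  assumes "i \<in> {1..l}"
  shows "hypertorus l (vscale 2 (eps i)) = pt_torus l i 1 \<union> pt_torus l i (-1)"
proof -
  have "(\<Prod>k=1..l. t k powi (vscale 2 (eps i)) k) = (\<Prod>k\<in>{i}. t k powi (vscale 2 (eps i)) k)"
    for t :: "nat \<Rightarrow> complex"
    by (rule prod_support) (use assms in \<open>auto simp: vscale_def eps_def\<close>)
  then have "(\<Prod>k=1..l. t k powi (vscale 2 (eps i)) k) = (t i)\<^sup>2" for t :: "nat \<Rightarrow> complex"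
    by (simp add: vscale_def eps_def)
  then show ?thesis
    unfolding hypertorus_def pt_torus_def by (auto simp: power2_eq_1_iff)
qed

lemma components_pair:
  assumes "1 \<le> i" "i < j" "j \<le> l"
  shows "components (hypertorus l ((if \<sigma> then vadd else vsub) (eps i) (eps j))) = {pair_torus l i (j, \<sigma>)}"
proof -
  have "connected (pair_torus l i (j, \<sigma>))"
    using graph_connected[OF graph_pair] assms by simp
  moreover have "(\<lambda>_. 1) \<in> pair_torus l i (j, \<sigma>)" by (simp add: pair_torus_def one_in_torus)
  then have "pair_torus l i (j, \<sigma>) \<noteq> {}" by blast
  ultimately show ?thesis
    unfolding hypertorus_pair[OF assms] by (simp add: components_eq_sing_iff)
qed

lemma toric_arr_rows:
  assumes "I \<subseteq> pos_roots_C l"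
  shows "toric_arr l I = (\<Union>i\<in>{1..l}. row_arr l I i)"
proof (intro subset_antisym subsetI)
  fix X assume "X \<in> toric_arr l I"
  then obtain \<beta> where \<beta>: "\<beta> \<in> I" "X \<in> components (hypertorus l \<beta>)" by (auto simp: toric_arr_def)
  then consider i where "\<beta> = vscale 2 (eps i)" "i \<in> {1..l}"
    | i j \<sigma> where "\<beta> = (if \<sigma> then vadd else vsub) (eps i) (eps j)" "1 \<le> i" "i < j" "j \<le> l"
  proof -
    assume 1: "\<And>i. \<beta> = vscale 2 (eps i) \<Longrightarrow> i \<in> {1..l} \<Longrightarrow> thesis"
      and 2: "\<And>\<sigma> i j. \<beta> = (if \<sigma> then vadd else vsub) (eps i) (eps j) \<Longrightarrow> 1 \<le> i \<Longrightarrow> i < j \<Longrightarrow> j \<le> l \<Longrightarrow> thesis"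
    show thesis
      using \<beta>(1) assms 1 2[of True] 2[of False] by (auto simp: pos_roots_C_def)
  qed
  then show "X \<in> (\<Union>i\<in>{1..l}. row_arr l I i)"
  proof cases
    case (1 i)
    then have "X \<in> row_arr l I i"
      using \<beta> hypertorus_double[OF 1(2)] components_pt[OF 1(2)] by (auto simp: row_arr_def)
    then show ?thesis using 1 by blast
  next
    case (2 i j \<sigma>)
    then have "X = pair_torus l i (j, \<sigma>)" using \<beta>(2) components_pair[OF 2(2-4), of \<sigma>] by simp
    moreover have "(j, \<sigma>) \<in> row_idx l I i" using 2 \<beta>(1) by (simp add: row_idx_def)
    ultimately have "X \<in> row_arr l I i" by (simp add: row_arr_def)
    then show ?thesis using 2 by auto
  qed
next
  fix X assume "X \<in> (\<Union>i\<in>{1..l}. row_arr l I i)"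
  then obtain i where i: "i \<in> {1..l}" "X \<in> row_arr l I i" by blast
  then consider "vscale 2 (eps i) \<in> I" "X \<in> {pt_torus l i 1, pt_torus l i (-1)}"
    | j \<sigma> where "(j, \<sigma>) \<in> row_idx l I i" "X = pair_torus l i (j, \<sigma>)"
    by (auto simp: row_arr_def split: if_splits)
  then show "X \<in> toric_arr l I"
  proof cases
    case 1
    then have "X \<in> components (hypertorus l (vscale 2 (eps i)))"
      using hypertorus_double[OF i(1)] components_pt[OF i(1)] by simp
    then show ?thesis using 1 by (auto simp: toric_arr_def)
  next
    case (2 j \<sigma>)
    have "X \<in> components (hypertorus l ((if \<sigma> then vadd else vsub) (eps i) (eps j)))"
      using components_pair[of i j l \<sigma>] 2 i by (simp add: row_idx_def)
    then show ?thesis using 2 unfolding toric_arr_def row_idx_def by blast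
  qed
qed

lemma finite_row_idx: "finite (row_idx l I i)"
  by (rule finite_subset[of _ "{..l} \<times> UNIV"]) (auto simp: row_idx_def)

lemma finite_row_arr: "finite (row_arr l I i)"
  by (simp add: row_arr_def finite_row_idx)

text \<open>A separating point: \<open>\<i>\<close> is neither 1 nor -1 nor its own inverse, and all
  coordinates other than \<open>i\<close> and \<open>j\<close> are 1. No other hypersurface of row
  \<open>i\<close> passes through it.\<close>

lemma pair_torus_point:
  assumes "1 \<le> i" "i < j" "j \<le> l"
  shows "(\<lambda>_. 1)(i := \<i>, j := (if \<sigma> then inverse \<i> else \<i>)) \<in> pair_torus l i (j, \<sigma>)"
  using assms by (auto simp: pair_torus_def torus_def)

lemma b_num_eq_card: "b_num l I i = card (row_idx l I i)"
proof -
  have inj: "inj_on (\<lambda>(j, \<sigma>). (if \<sigma> then vadd else vsub) (eps i) (eps j)) (row_idx l I i)"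
  proof (rule inj_onI)
    fix p q assume p: "p \<in> row_idx l I i" and q: "q \<in> row_idx l I i"
      and eq: "(\<lambda>(j, \<sigma>). (if \<sigma> then vadd else vsub) (eps i) (eps j)) p
        = (\<lambda>(j, \<sigma>). (if \<sigma> then vadd else vsub) (eps i) (eps j)) q"
    obtain j \<sigma> where j: "p = (j, \<sigma>)" "i < j" "j \<le> l" using p by (auto simp: row_idx_def)
    obtain k \<tau> where k: "q = (k, \<tau>)" "i < k" "k \<le> l" using q by (auto simp: row_idx_def)
    \<comment> \<open>At coordinate \<open>j\<close> the left side is 1 or -1, so the right side is
      nonzero and \<open>k = j\<close>; the sign then recovers \<open>\<sigma>\<close>.\<close>
    have "(if \<sigma> then vadd else vsub) (eps i) (eps j) j = (if \<tau> then vadd else vsub) (eps i) (eps k) j"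
      using eq j k by simp
    then show "p = q"
      using j k by (auto simp: vadd_def vsub_def eps_def split: if_splits)
  qed
  have "E_set l I i = (\<lambda>(j, \<sigma>). (if \<sigma> then vadd else vsub) (eps i) (eps j)) ` row_idx l I i"
  proof (intro subset_antisym subsetI)
    fix \<beta> assume "\<beta> \<in> E_set l I i"
    then obtain j where j: "\<beta> \<in> I" "i < j" "j \<le> l"
      "\<beta> = vadd (eps i) (eps j) \<or> \<beta> = vsub (eps i) (eps j)" by (auto simp: E_set_def)
    then obtain \<sigma> where "\<beta> = (if \<sigma> then vadd else vsub) (eps i) (eps j)"
      by (metis (full_types))
    then show "\<beta> \<in> (\<lambda>(j, \<sigma>). (if \<sigma> then vadd else vsub) (eps i) (eps j)) ` row_idx l I i"
      using j by (intro image_eqI[of _ _ "(j, \<sigma>)"]) (auto simp: row_idx_def)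
  qed (auto simp: E_set_def row_idx_def split: if_splits)
  then show ?thesis by (simp add: b_num_def card_image inj)
qed

text \<open>Exponents count hypersurfaces rather than roots, so distinct roots must be shown to give
  distinct sets; the separating point does this. The root \<open>2\<epsilon>\<^sub>i\<close> counts
  twice, for its two components.\<close>

lemma card_row_arr:
  assumes i: "i \<in> {1..l}"
  shows "card (row_arr l I i) = b_num l I i + (if vscale 2 (eps i) \<in> I then 2 else 0)"
proof -
  have "inj_on (pair_torus l i) (row_idx l I i)"
  proof (rule inj_onI)
    fix p q assume p: "p \<in> row_idx l I i" and q: "q \<in> row_idx l I i"
      and eq: "pair_torus l i p = pair_torus l i q"
    obtain j \<sigma> where j: "p = (j, \<sigma>)" "i < j" "j \<le> l" using p by (auto simp: row_idx_def)
    obtain k \<tau> where k: "q = (k, \<tau>)" "i < k" "k \<le> l" using q by (auto simp: row_idx_def)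
    have "(\<lambda>_. 1)(i := \<i>, j := (if \<sigma> then inverse \<i> else \<i>)) \<in> pair_torus l i (k, \<tau>)"
      using pair_torus_point[of i j l \<sigma>] i j eq k(1) by simp
    then have "\<i> = (if \<tau> then inverse (if k = j then if \<sigma> then inverse \<i> else \<i> else 1)
        else if k = j then if \<sigma> then inverse \<i> else \<i> else 1)"
      using j k by (simp add: pair_torus_def split: if_splits)
    then show "p = q" using j(1) k(1) by (auto simp: complex_eq_iff split: if_splits)
  qed
  then have b: "b_num l I i = card (pair_torus l i ` row_idx l I i)"
    by (simp add: b_num_eq_card card_image)
  have ne: "pt_torus l i 1 \<noteq> pt_torus l i (-1)"
  proof
    assume "pt_torus l i 1 = pt_torus l i (-1)"
    moreover have "(\<lambda>_. 1) \<in> pt_torus l i 1" by (simp add: pt_torus_def one_in_torus)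
    ultimately show False by (simp add: pt_torus_def)
  qed
  have "pair_torus l i p \<noteq> pt_torus l i z" if p: "p \<in> row_idx l I i" and z: "z = 1 \<or> z = -1" for p z
  proof
    assume eq: "pair_torus l i p = pt_torus l i z"
    obtain j \<sigma> where j: "p = (j, \<sigma>)" "i < j" "j \<le> l" using p by (auto simp: row_idx_def)
    have "(\<lambda>_. 1)(i := \<i>, j := (if \<sigma> then inverse \<i> else \<i>)) \<in> pt_torus l i z"
      using pair_torus_point[of i j l \<sigma>] i j eq by simp
    then show False using z j by (auto simp: pt_torus_def complex_eq_iff)
  qed
  then have "pair_torus l i ` row_idx l I i \<inter> {pt_torus l i 1, pt_torus l i (-1)} = {}" by auto
  then show ?thesis
    using ne by (simp add: row_arr_def b card_Un_disjoint finite_row_idx)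
qed

text \<open>Every other root of row \<open>i\<close> lies below \<open>2\<epsilon>\<^sub>i\<close>,
  so the row is full: both signs for each of the \<open>l - i\<close> later coordinates, plus the
  two components of \<open>2\<epsilon>\<^sub>i\<close>.\<close>

lemma card_row_arr_double:
  assumes "root_ideal l I" and i: "i \<in> {1..l}" and d: "vscale 2 (eps i) \<in> I"
  shows "card (row_arr l I i) = 2 * (l - i + 1)"
proof -
  have "row_idx l I i = {i<..l} \<times> UNIV"
    using ideal_double_row[OF assms(1) d] i by (auto simp: row_idx_def)
  then have "b_num l I i = 2 * (l - i)"
    by (simp add: b_num_eq_card card_cartesian_product card_UNIV_bool)
  then show ?thesis using card_row_arr[OF i, of I] d by simp
qed

section \<open>Ideals of type C\<close>

lemma inverse_eq_swap: "inverse x = y \<longleftrightarrow> x = inverse y" for x y :: complex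
  by auto

context
  fixes l :: nat and I :: "ivec set"
  assumes ideal: "root_ideal l I"
begin

lemma row_arr_cases:
  assumes "a \<in> row_arr l I i"
  obtains j \<sigma> where "(j, \<sigma>) \<in> row_idx l I i" "a = pair_torus l i (j, \<sigma>)"
  | z where "vscale 2 (eps i) \<in> I" "z = 1 \<or> z = -1" "a = pt_torus l i z"
  using assms by (auto simp: row_arr_def split: if_splits)

lemma row_arr_double:
  assumes "1 \<le> i" "vscale 2 (eps i) \<in> I \<or> (i, True) \<in> row_idx l I k" "1 \<le> k" "k \<le> i" "i \<le> l"
    "z = 1 \<or> z = -1"
  shows "pt_torus l i z \<in> row_arr l I i"
proof -
  have "vscale 2 (eps i) \<in> I"
    using assms ideal_sum_double[OF ideal, of k i] by (auto simp: row_idx_def)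
  then show ?thesis using assms(6) by (auto simp: row_arr_def)
qed

text \<open>Symmetrized form of the assumption \<open>coincide\<close> of \<open>graph_arrangement\<close>, so that each
  unordered pair of hypersurfaces is treated once.\<close>

definition coincides :: "nat \<Rightarrow> (nat \<Rightarrow> complex) \<Rightarrow> (nat \<Rightarrow> complex) set \<Rightarrow> (nat \<Rightarrow> complex) set \<Rightarrow> bool" where
  "coincides i t a b \<longleftrightarrow> (\<exists>d\<in>(\<Union>k\<in>{i<..l}. row_arr l I k). \<forall>X. connected X \<longrightarrow> t \<in> X \<longrightarrow>
     (X \<subseteq> a \<longrightarrow> (X \<subseteq> b \<longleftrightarrow> X \<subseteq> d)) \<and> (X \<subseteq> b \<longrightarrow> (X \<subseteq> a \<longleftrightarrow> X \<subseteq> d)))"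

lemma coincides_sym: "coincides i t a b \<Longrightarrow> coincides i t b a"
  unfolding coincides_def by (erule bexE) (rule bexI; simp)

lemma coincidesI:
  assumes "d \<in> row_arr l I k" "i < k" "k \<le> l"
    "\<And>s. s \<in> a \<Longrightarrow> s \<in> b \<longleftrightarrow> s \<in> d" "\<And>s. s \<in> b \<Longrightarrow> s \<in> a \<longleftrightarrow> s \<in> d"
  shows "coincides i t a b"
proof -
  have "d \<in> (\<Union>k\<in>{i<..l}. row_arr l I k)" using assms(1-3) by auto
  moreover have "X \<subseteq> a \<Longrightarrow> X \<subseteq> b \<longleftrightarrow> X \<subseteq> d" "X \<subseteq> b \<Longrightarrow> X \<subseteq> a \<longleftrightarrow> X \<subseteq> d" for X
    using assms(4,5) by (meson subset_iff)+
  ultimately show ?thesis unfolding coincides_def by (intro bexI[of _ d]) simp_all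
qed

text \<open>Because \<open>z\<close> is its own inverse, \<open>t\<^sub>i = z\<close> meets either
  of \<open>t\<^sub>i = t\<^sub>j\<close> and \<open>t\<^sub>i = 1/t\<^sub>j\<close> exactly where
  \<open>t\<^sub>j = z\<close>, and \<open>2\<epsilon>\<^sub>j\<close> lies below
  \<open>2\<epsilon>\<^sub>i\<close>.\<close>

lemma coincides_pair_pt:
  assumes i: "1 \<le> i" "vscale 2 (eps i) \<in> I" "z = 1 \<or> z = -1" and j: "i < j" "j \<le> l"
  shows "coincides i t (pair_torus l i (j, \<sigma>)) (pt_torus l i z)"
proof (rule coincidesI)
  show "pt_torus l j z \<in> row_arr l I j"
    by (rule row_arr_double[of j j]) (use ideal_double_double[OF ideal i(2,1)] i j in auto)
qed (use i j in \<open>auto simp: pair_torus_def pt_torus_def inverse_eq_swap\<close>)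

text \<open>Equal signs agree where \<open>t\<^sub>j = t\<^sub>k\<close>, opposite signs where
  \<open>t\<^sub>j = 1/t\<^sub>k\<close>; hence the exclusive or of the flags. In each of the four
  cases the root of this locus lies below one of the two given roots.\<close>

lemma coincides_pair_pair:
  assumes i: "1 \<le> i" and j: "(j, \<sigma>) \<in> row_idx l I i" and k: "(k, \<tau>) \<in> row_idx l I i" and jk: "j < k"
  shows "coincides i t (pair_torus l i (j, \<sigma>)) (pair_torus l i (k, \<tau>))"
proof (rule coincidesI)
  have "(k, \<sigma> \<noteq> \<tau>) \<in> row_idx l I j"
    using i j k jk ideal_diff_diff[OF ideal, of i k j] ideal_sum_sum[OF ideal, of i k j]
      ideal_sum_sum[OF ideal, of i j k] ideal_sum_diff[OF ideal, of i j k]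
      vadd_commute[of "eps j" "eps k"]
    by (cases \<sigma>; cases \<tau>) (auto simp: row_idx_def)
  then show "pair_torus l j (k, \<sigma> \<noteq> \<tau>) \<in> row_arr l I j" by (simp add: row_arr_def)
qed (use j jk in \<open>auto simp: pair_torus_def row_idx_def inverse_eq_swap split: if_splits\<close>)

text \<open>The only intersection that splits: \<open>t\<^sub>i = t\<^sub>j = t\<^sub>j\<^sup>-\<^sup>1\<close> has the two components
  \<open>t\<^sub>j = 1\<close> and \<open>t\<^sub>j = -1\<close>, and connectedness selects one of them.\<close>

lemma coincides_opposite:
  assumes i: "1 \<le> i" and j: "(j, True) \<in> row_idx l I i"
    and t: "t \<in> pair_torus l i (j, True)" "t \<in> pair_torus l i (j, False)"
  shows "coincides i t (pair_torus l i (j, True)) (pair_torus l i (j, False))"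
proof -
  have sgn: "s j = 1 \<or> s j = -1" if "s \<in> pair_torus l i (j, True)" "s \<in> pair_torus l i (j, False)" for s
  proof -
    have "s j * s j = 1" using that torus_nz[of s l j] by (auto simp: pair_torus_def field_simps)
    then show ?thesis using square_eq_1_iff by blast
  qed
  have d: "pt_torus l j (t j) \<in> (\<Union>k\<in>{i<..l}. row_arr l I k)"
    using row_arr_double[of j i "t j"] sgn[OF t] i j by (auto simp: row_idx_def)
  have sub: "X \<subseteq> pair_torus l i (j, \<sigma>) \<Longrightarrow> X \<subseteq> pair_torus l i (j, \<not> \<sigma>) \<longleftrightarrow> X \<subseteq> pt_torus l j (t j)"
    if X: "connected X" "t \<in> X" for X \<sigma>
  proof
    assume a: "X \<subseteq> pair_torus l i (j, \<sigma>)" "X \<subseteq> pair_torus l i (j, \<not> \<sigma>)"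
    have both: "s \<in> pair_torus l i (j, True) \<and> s \<in> pair_torus l i (j, False)" if "s \<in> X" for s
      using a that by (cases \<sigma>) auto
    show "X \<subseteq> pt_torus l j (t j)"
    proof
      fix s assume s: "s \<in> X"
      have "s j = t j"
        by (rule connected_sign_constant[OF X]) (use both sgn s in auto)
      then show "s \<in> pt_torus l j (t j)" using both[OF s] by (simp add: pair_torus_def pt_torus_def)
    qed
  next
    assume a: "X \<subseteq> pair_torus l i (j, \<sigma>)" "X \<subseteq> pt_torus l j (t j)"
    show "X \<subseteq> pair_torus l i (j, \<not> \<sigma>)"
    proof
      fix s assume "s \<in> X"
      then have "s \<in> pair_torus l i (j, \<sigma>)" "s j = t j" using a by (auto simp: pt_torus_def)
      then show "s \<in> pair_torus l i (j, \<not> \<sigma>)"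
        using sgn[OF t] by (auto simp: pair_torus_def)
    qed
  qed
  show ?thesis
    unfolding coincides_def using d sub[of _ True] sub[of _ False] by (intro bexI[OF _ d]) simp
qed

lemma row_coincides:
  assumes i: "1 \<le> i" and a: "a \<in> row_arr l I i" and b: "b \<in> row_arr l I i" and ab: "a \<noteq> b"
    and t: "t \<in> a" "t \<in> b"
  shows "coincides i t a b"
proof (cases rule: row_arr_cases[OF a])
  case a: (1 j \<sigma>)
  show ?thesis
  proof (cases rule: row_arr_cases[OF b])
    case b: (1 k \<tau>)
    consider "j < k" | "k < j" | "j = k" by linarith
    then show ?thesis
    proof cases
      case 1
      then show ?thesis using coincides_pair_pair[OF i a(1) b(1)] a b by simp
    next
      case 2
      then show ?thesis using coincides_sym[OF coincides_pair_pair[OF i b(1) a(1)]] a b by simp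
    next
      case 3
      show ?thesis
        using coincides_opposite[OF i, of j t] coincides_sym[OF coincides_opposite[OF i, of j t]]
          a b t ab 3 by (cases \<sigma>; cases \<tau>) auto
    qed
  next
    case b: (2 z)
    then show ?thesis using coincides_pair_pt[OF i b(1,2)] a by (simp add: row_idx_def)
  qed
next
  case a: (2 z)
  show ?thesis
  proof (cases rule: row_arr_cases[OF b])
    case b: (1 k \<tau>)
    then show ?thesis using coincides_sym[OF coincides_pair_pt[OF i a(1,2)]] a by (simp add: row_idx_def)
  next
    \<comment> \<open>Distinct values \<open>z\<close> and \<open>w\<close> give disjoint
      hypersurfaces, which contradicts the common point \<open>t\<close>.\<close>
    case (2 w)
    then show ?thesis using a ab t by (auto simp: pt_torus_def)
  qed
qed

lemma row_graph_arrangement: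
  assumes i: "i \<in> {1..l}"
  shows "graph_arrangement l i (\<Union>k\<in>{i<..l}. row_arr l I k) (row_arr l I i)"
proof
  show "i \<in> {1..l}" by (rule i)
  show "finite (row_arr l I i)" by (rule finite_row_arr)
  show "saturated i b" if b: "b \<in> (\<Union>k\<in>{i<..l}. row_arr l I k)" for b
  proof -
    obtain k where k: "i < k" "b \<in> row_arr l I k" using b by auto
    show ?thesis
      by (cases rule: row_arr_cases[OF k(2)])
        (use k(1) torus_upd[OF _ i] in \<open>auto simp: saturated_def pair_torus_def pt_torus_def row_idx_def\<close>)
  qed
  show "graph_over l i a" if a: "a \<in> row_arr l I i" for a
    by (cases rule: row_arr_cases[OF a])
      (auto simp: row_idx_def intro: graph_pair graph_pt)
  show "\<exists>d\<in>\<Union>k\<in>{i<..l}. row_arr l I k. \<forall>X. connected X \<longrightarrow> t \<in> X \<longrightarrow> X \<subseteq> a \<longrightarrow> (X \<subseteq> b) = (X \<subseteq> d)"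
    if "a \<in> row_arr l I i" "b \<in> row_arr l I i" "a \<noteq> b" "t \<in> a" "t \<in> b" for a b t
  proof -
    have "coincides i t a b" using row_coincides[OF _ that] i by simp
    then show ?thesis unfolding coincides_def by (elim bexE) (rule bexI; simp)
  qed
qed

text \<open>The last \<open>n\<close> coordinates have been treated. An empty row changes neither
  the arrangement nor the layers, so only positive row sizes are recorded as exponents.\<close>

lemma tower_rows:
  assumes "n \<le> l"
  shows "tower (layers_of (torus l) (\<Union>k\<in>{l - n<..l}. row_arr l I k)) (torus l) (\<Union>k\<in>{l - n<..l}. row_arr l I k)
    (filter_mset (\<lambda>d. 0 < d) (image_mset (\<lambda>k. card (row_arr l I k)) (mset_set {l - n<..l})))"
  using assms
proof (induction n)
  case 0
  then show ?case using tower_base by (simp add: layers_of_empty)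
next
  case (Suc n)
  define i where "i = l - n"
  have i: "i \<in> {1..l}" and iS: "l - Suc n = i - 1" using Suc.prems by (auto simp: i_def)
  have rng: "{i - 1<..l} = insert i {i<..l}" using i by auto
  let ?B = "\<Union>k\<in>{i<..l}. row_arr l I k" and ?A = "row_arr l I i"
  have U: "(\<Union>k\<in>insert i {i<..l}. row_arr l I k) = ?B \<union> ?A" by auto
  interpret graph_arrangement l i ?B ?A by (rule row_graph_arrangement[OF i])
  have IH: "tower (layers_of (torus l) ?B) (torus l) ?B
      (filter_mset (\<lambda>d. 0 < d) (image_mset (\<lambda>k. card (row_arr l I k)) (mset_set {i<..l})))"
    using Suc by (simp add: i_def)
  show ?case
  proof (cases "?A = {}")
    case True
    then show ?thesis
      using IH unfolding iS rng U by simp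
  next
    case False
    then have "0 < card ?A" using finA by (simp add: card_gt_0_iff)
    then show ?thesis
      using tower_step[OF IH sections False] unfolding iS rng U layers_of_Un_eq by simp
  qed
qed

end

section \<open>The indices \<open>s\<close> and \<open>n\<close>, and the final count\<close>

lemma s_idx_props:
  assumes "root_ideal l I"
  shows "1 \<le> s_idx l I" "s_idx l I \<le> Suc l"
    "\<And>i. i \<in> {1..l} \<Longrightarrow> vscale 2 (eps i) \<in> I \<longleftrightarrow> s_idx l I \<le> i"
proof -
  let ?S = "{i. 1 \<le> i \<and> i \<le> l \<and> vscale 2 (eps i) \<in> I} \<union> {Suc l}"
  have fin: "finite ?S" by simp
  have mem: "s_idx l I \<in> ?S" unfolding s_idx_def by (rule Min_in[OF fin]) simp
  then show s1: "1 \<le> s_idx l I" "s_idx l I \<le> Suc l" by auto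
  fix i assume i: "i \<in> {1..l}"
  show "vscale 2 (eps i) \<in> I \<longleftrightarrow> s_idx l I \<le> i"
  proof
    assume "vscale 2 (eps i) \<in> I"
    then show "s_idx l I \<le> i" unfolding s_idx_def using i by (intro Min_le[OF fin]) auto
  next
    assume le: "s_idx l I \<le> i"
    then have "vscale 2 (eps (s_idx l I)) \<in> I" using mem i by auto
    then show "vscale 2 (eps i) \<in> I"
      using ideal_double_double[OF assms _ s1(1) le] i by simp
  qed
qed

lemma n_idx_props:
  assumes "root_ideal l I"
  shows "1 \<le> n_idx l I" "n_idx l I \<le> s_idx l I"
    "\<And>i. \<lbrakk>1 \<le> i; i < n_idx l I\<rbrakk> \<Longrightarrow> b_num l I i = 0"
proof -
  let ?S = "{i. 1 \<le> i \<and> i \<le> l \<and> E_set l I i \<noteq> {}} \<union> {s_idx l I}"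
  have fin: "finite ?S" by simp
  have mem: "n_idx l I \<in> ?S" unfolding n_idx_def by (rule Min_in[OF fin]) simp
  then show "1 \<le> n_idx l I" using s_idx_props(1)[OF assms] by auto
  show ns: "n_idx l I \<le> s_idx l I" unfolding n_idx_def by (rule Min_le[OF fin]) simp
  fix i assume i: "1 \<le> i" "i < n_idx l I"
  then have "i \<le> l" using ns s_idx_props(2)[OF assms] by simp
  have "i \<notin> ?S" using Min_le[OF fin, of i] i(2) unfolding n_idx_def[symmetric] by auto
  then have "E_set l I i = {}" using i \<open>i \<le> l\<close> by simp
  then show "b_num l I i = 0" by (simp add: b_num_def)
qed

text \<open>Rows before \<open>n\<close> are empty, rows from \<open>n\<close> to
  \<open>s - 1\<close> contain only graphs of pairs, and rows from \<open>s\<close> on are full.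
  Since \<open>n \<ge> 1\<close>, the subtraction \<open>n - 1\<close> is not truncated.\<close>

lemma exponents_eq:
  assumes "root_ideal l I"
  shows "replicate_mset (n_idx l I - 1) 0
      + image_mset (b_num l I) (mset_set {n_idx l I..<s_idx l I})
      + image_mset (\<lambda>i. 2 * (l - i + 1)) (mset_set {s_idx l I..l})
    = image_mset (\<lambda>k. card (row_arr l I k)) (mset_set {0<..l})"
proof -
  let ?n = "n_idx l I" and ?s = "s_idx l I" and ?c = "\<lambda>k. card (row_arr l I k)"
  note s = s_idx_props[OF assms] and n = n_idx_props[OF assms]
  have low: "?c i = b_num l I i" if "1 \<le> i" "i < ?s" for i
    using card_row_arr[of i l I] s(2) s(3)[of i] that by auto
  have "image_mset ?c (mset_set {1..<?n}) = image_mset (\<lambda>_. 0) (mset_set {1..<?n})"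
    by (rule image_mset_cong) (use low n in auto)
  then have 1: "image_mset ?c (mset_set {1..<?n}) = replicate_mset (?n - 1) 0"
    by (simp add: image_mset_const_eq)
  have 2: "image_mset ?c (mset_set {?n..<?s}) = image_mset (b_num l I) (mset_set {?n..<?s})"
    by (rule image_mset_cong) (use low n in auto)
  have 3: "image_mset ?c (mset_set {?s..l}) = image_mset (\<lambda>i. 2 * (l - i + 1)) (mset_set {?s..l})"
    by (rule image_mset_cong) (use card_row_arr_double[OF assms] s in auto)
  have "{0<..l} = {1..<?n} \<union> {?n..<?s} \<union> {?s..l}" using s(1,2) n(1,2) by auto
  then have "mset_set {0<..l} = mset_set ({1..<?n} \<union> {?n..<?s}) + mset_set {?s..l}"
    using n(2) by (simp only:) (rule mset_set_Union; auto)
  also have "mset_set ({1..<?n} \<union> {?n..<?s}) = mset_set {1..<?n} + mset_set {?n..<?s}"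
    by (rule mset_set_Union) auto
  finally show ?thesis by (simp only: image_mset_union 1 2 3)
qed

theorem theorem7p9:
  fixes l :: nat and I :: "ivec set"
  assumes "1 \<le> l"
    and "root_ideal l I"
  shows "strictly_supersolvable (layers l I) rev_incl \<and>
         has_exponents l I
           (replicate_mset (n_idx l I - 1) 0
            + image_mset (b_num l I) (mset_set {n_idx l I..<s_idx l I})
            + image_mset (\<lambda>i. 2 * (l - i + 1)) (mset_set {s_idx l I..l}))"
proof -
  define E where "E = image_mset (\<lambda>k. card (row_arr l I k)) (mset_set {0<..l})"
  \<comment> \<open>The zeros are separated by value and not by index, as the middle block may
    contribute one too: if \<open>s = l + 1\<close> and \<open>n \<le> l\<close>, then
    \<open>b\<^sub>l = 0\<close> because no coordinate follows \<open>l\<close>. As \<open>E\<close>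
    has one entry per row, the number of its zeros is \<open>l - size ds\<close>.\<close>
  define ds where "ds = filter_mset (\<lambda>d. 0 < d) E"
  have arr: "toric_arr l I = (\<Union>k\<in>{0<..l}. row_arr l I k)"
  proof -
    have "I \<subseteq> pos_roots_C l" using assms(2) by (simp add: root_ideal_def)
    moreover have "{1..l} = {0<..l}" by auto
    ultimately show ?thesis using toric_arr_rows by simp
  qed
  have tower: "tower (layers l I) (torus l) (toric_arr l I) ds"
    using tower_rows[OF assms(2) order_refl] by (simp add: layers_eq_layers_of arr ds_def E_def)
  have "E = filter_mset (\<lambda>d. d = 0) E + ds"
    unfolding ds_def using multiset_partition[of E "\<lambda>d. d = 0"] by simp
  moreover have "filter_mset (\<lambda>d. d = 0) E = replicate_mset (count E 0) 0"
    using filter_eq_replicate_mset[of 0 E] by (simp add: eq_commute)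
  ultimately have E: "E = replicate_mset (count E 0) 0 + ds" by simp
  moreover have "size E = l" by (simp add: E_def)
  ultimately have sz: "count E 0 = l - size ds" "size ds \<le> l"
    by (metis add_diff_cancel_right' size_replicate_mset size_union, metis le_add2 size_union)
  have "has_exponents l I E"
    unfolding has_exponents_def Let_def tower_strictly_supersolvable(2)[OF tower]
    using tower_char_poly[OF tower sz(2)] E sz(1)
    by (intro exI[of _ ds]) (simp add: ds_def)
  then show ?thesis
    using tower_strictly_supersolvable(1)[OF tower] exponents_eq[OF assms(2)] by (simp add: E_def)
qed

end
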